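(* Let $r\in\mathbb{N}$, let $a\in (l_0(\mathbb{Z}))^{r\times r}$ and $v\in (l_0(\mathbb{Z}))^{1\times r}$ with $\widehat{v}(0)\neq 0$. For a nonnegative integer $m$, the following statements are equivalent to each other: (1) $\mathcal{S}_a \mathscr{P}_{m,v}=\mathscr{P}_{m,v}$ and $\mathcal{S}_a(\widehat{v}(0))=\widehat{v}(0)$, where $\widehat{v}(0)$ is regarded as a constant vector sequence. (2) $\mathcal{S}_a \vec{p}\in \mathrm{span}\{\vec{p},\vec{p}\,',\ldots,\vec{p}^{\,(m)}\}$ and $\mathcal{S}_a(\vec{p}^{\,(m)})=\vec{p}^{\,(m)}$, where $\vec{p}:=\frac{(\cdot)^m}{m!}*v$. (3) There exists a finitely supported sequence $c\in l_0(\mathbb{Z})$ with $\widehat{c}(0)=1$ such that, as $\xi\to 0$, $$\widehat{v}(2\xi)\widehat{a}(\xi)=\widehat{c}(\xi)\widehat{v}(\xi)+O(|\xi|^{m+1})\quad\text{and}\quad \widehat{v}(2\xi)\widehat{a}(\xi+\pi)=O(|\xi|^{m+1}).$$ (4) There exists a finitely supported sequence $d\in l_0(\mathbb{Z})$ with $\widehat{d}(0)=1$ such that the sequence $\upsilon_a\in (l_0(\mathbb{Z}))^{1\times r}$ defined by $\widehat{\upsilon_a}(\xi):=\widehat{d}(\xi)\widehat{v}(\xi)$ satisfies, as $\xi\to 0$, $$\widehat{\upsilon_a}(2\xi)\widehat{a}(\xi)=\widehat{\upsilon_a}(\xi)+O(|\xi|^{m+1})\quad\text{and}\quad \widehat{\upsilon_a}(2\xi)\widehat{a}(\xi+\pi)=O(|\xi|^{m+1})$$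 (i.e., $a$ has order $m+1$ sum rules with respect to $\upsilon_a$). (5) $\mathcal{S}_a\mathscr{P}_{m,v}\subseteq\mathscr{P}_{m,v}$ and all the eigenvalues of $\mathcal{S}_a:\mathscr{P}_{m,v}\to\mathscr{P}_{m,v}$ are $2^{-j}$ for $j=0,\ldots,m$. More precisely, $\mathcal{S}_a\vec{p}_j=2^{-j}\vec{p}_j$ and $\vec{p}_j=\vec{p}_m^{\,(m-j)}$ for $j=0,\ldots,m$, where $$\vec{p}_j(x):=\Big(\frac{(\cdot)^j}{j!}*\upsilon_a\Big)(x)=\sum_{k=0}^{j}\frac{(-i)^k}{k!(j-k)!}x^{j-k}\,\widehat{\upsilon_a}^{(k)}(0)$$ and $\upsilon_a$ is a sequence as given in item (4). (Here $\mathscr{P}_{m,\upsilon_a}=\mathscr{P}_{m,v}$ and $\deg(\vec{p}_j)=j$ for all $j=0,\ldots,m$.) (6) $\mathcal{S}_a\vec{p}_m=2^{-m}\vec{p}_m$ for some $\vec{p}_m\in\mathscr{P}_{m,v}$ satisfying $\deg(\vec{p}_m)=m$. Moreover, any of the items (1)--(6) implies (with $\upsilon_a$ as in item (4)) that $\mathcal{S}_a(q*\upsilon_a)=(q(2^{-1}\cdot))*\upsilon_a$ for all $q\in\Pi_m$, and that for all $\vec{q}\in\mathscr{P}_{m,v}$ and all integers $j\ge 0$, $$\mathcal{S}_a(\vec{q}^{\,(j)})=2^j[\mathcal{S}_a\vec{q}\,]^{(j)}=(\vec{q}^{\,(j)}(2^{-1}\cdot))*a=\sum_{k=0}^\inf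ty\frac{(-i)^k}{k!\,2^k}\,\vec{q}^{\,(j+k)}(2^{-1}\cdot)\,\widehat{a}^{(k)}(0).$$
   Context: Notation. $(l(\mathbb{Z}))^{s\times r}$ is the space of all sequences $u=\{u(k)\}_{k\in\mathbb{Z}}:\mathbb{Z}\to\mathbb{C}^{s\times r}$, and $(l_0(\mathbb{Z}))^{s\times r}$ is the subspace of finitely supported sequences; $l_0(\mathbb{Z})$ is the case $s=r=1$. For $u\in (l_0(\mathbb{Z}))^{s\times r}$, its symbol is $\widehat{u}(\xi):=\sum_{k\in\mathbb{Z}}u(k)e^{-ik\xi}$, $\xi\in\mathbb{R}$. For $a\in (l_0(\mathbb{Z}))^{r\times r}$, the vector subdivision operator $\mathcal{S}_a:(l(\mathbb{Z}))^{s\times r}\to (l(\mathbb{Z}))^{s\times r}$ is $$(\mathcal{S}_a w)(j):=2\sum_{k\in\mathbb{Z}}w(k)a(j-2k),\quad j\in\mathbb{Z}.$$ $\widehat f(\xi)=\widehat g(\xi)+O(|\xi|^{m+1})$ as $\xi\to0$ means $\widehat f^{(j)}(0)=\widehat g^{(j)}(0)$ for all $j=0,\ldots,m$. $\Pi_m$ is the space of polynomials (complex coefficients) of degree at most $m$; $(\Pi_m)^{1\times r}$ is the space of row vectors of such polynomials, and the degree of a vector polynomial is the maximum of the degrees of its entries. A vector polynomial is identified with its restriction to $\mathbb{Z}$ (a vector sequence); derivatives of a polynomial sequence are those of the corresponding polynomial. For a (vector) polynomial $p$ and a finitely supported sequence $u$ of compatible size, $p*u:=\sum_{k\in\mathbb{Z}}p(\cdot-k)u(k)$.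 $p(2^{-1}\cdot)$ is the polynomial $x\mapsto p(x/2)$. For $v\in (l_0(\mathbb{Z}))^{1\times r}$, $\mathscr{P}_{m,v}:=\{p*v: p\in\Pi_m\}\subseteq(\Pi_m)^{1\times r}$. *)

theory Defs
  imports "HOL-Analysis.Analysis" "HOL-Computational_Algebra.Polynomial"
    "HOL-Library.Groups_Big_Fun"
begin

text \<open>
  Row vectors of length \<open>r\<close> are elements of \<^typ>\<open>complex^'r\<close>, and \<open>r \<times> r\<close> matrices are elements of
  \<^typ>\<open>complex^'r^'r\<close> (a row vector acts on them by \<open>x v* A\<close>). Sums over all integers are written
  with \<open>Sum_any\<close>; all of them have finitely many nonzero terms when \<open>fin_supp\<close> holds for the
  sequences involved.
\<close>

definition fin_supp :: "(int \<Rightarrow> 'a::zero) \<Rightarrow> bool" where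
  "fin_supp u \<longleftrightarrow> finite {k. u k \<noteq> 0}"

definition symbol :: "(int \<Rightarrow> complex) \<Rightarrow> real \<Rightarrow> complex" where
  "symbol u \<xi> = Sum_any (\<lambda>k. u k * exp (- (\<i> * of_int k * of_real \<xi>)))"

definition vsymbol :: "(int \<Rightarrow> complex^'r) \<Rightarrow> real \<Rightarrow> complex^'r" where
  "vsymbol u \<xi> = (\<chi> i. symbol (\<lambda>k. u k $ i) \<xi>)"

definition msymbol :: "(int \<Rightarrow> complex^'r^'s) \<Rightarrow> real \<Rightarrow> complex^'r^'s" where
  "msymbol u \<xi> = (\<chi> i j. symbol (\<lambda>k. u k $ i $ j) \<xi>)"

definition subdiv :: "(int \<Rightarrow> complex^'r^'r) \<Rightarrow> (int \<Rightarrow> complex^'r) \<Rightarrow> int \<Rightarrow> complex^'r" where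
  "subdiv a w j = 2 *s Sum_any (\<lambda>k. w k v* a (j - 2 * k))"

definition nth_deriv :: "nat \<Rightarrow> (real \<Rightarrow> 'a::real_normed_vector) \<Rightarrow> real \<Rightarrow> 'a" where
  "nth_deriv n f = ((\<lambda>g x. vector_derivative g (at x)) ^^ n) f"

text \<open>\<open>eq_upto_O n f g\<close> stands for \<open>f(\<xi>) = g(\<xi>) + O(|\<xi>|^n)\<close> as \<open>\<xi> \<rightarrow> 0\<close>; by convention this
  means equality of the derivatives at \<open>0\<close> of all orders below \<open>n\<close>.\<close>

definition eq_upto_O :: "nat \<Rightarrow> (real \<Rightarrow> 'a::real_normed_vector) \<Rightarrow> (real \<Rightarrow> 'a) \<Rightarrow> bool" where
  "eq_upto_O n f g \<longleftrightarrow> (\<forall>j<n. nth_deriv j f 0 = nth_deriv j g 0)"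

type_synonym 'r vpoly = "complex poly ^ 'r"

definition vp_eval :: "'r::finite vpoly \<Rightarrow> complex \<Rightarrow> complex^'r" where
  "vp_eval p x = (\<chi> i. poly (p $ i) x)"

definition vp_seq :: "'r::finite vpoly \<Rightarrow> int \<Rightarrow> complex^'r" where
  "vp_seq p k = vp_eval p (of_int k)"

definition vp_scale :: "complex \<Rightarrow> 'r::finite vpoly \<Rightarrow> 'r vpoly" where
  "vp_scale c p = (\<chi> i. smult c (p $ i))"

definition vp_deriv :: "'r::finite vpoly \<Rightarrow> 'r vpoly" where
  "vp_deriv p = (\<chi> i. pderiv (p $ i))"

definition vp_half :: "'r::finite vpoly \<Rightarrow> 'r vpoly" where
  "vp_half p = (\<chi> i. p $ i \<circ>\<^sub>p [:0, 1/2:])"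

text \<open>The zero polynomial has no degree \<open>n \<ge> 0\<close>, whereas \<open>degree 0 = 0\<close> in the library.\<close>

definition vp_has_degree :: "'r::finite vpoly \<Rightarrow> nat \<Rightarrow> bool" where
  "vp_has_degree p n \<longleftrightarrow> p \<noteq> 0 \<and> Max (range (\<lambda>i. degree (p $ i))) = n"

lemma vector_space_vp_scale: "vector_space (vp_scale :: complex \<Rightarrow> 'r::finite vpoly \<Rightarrow> 'r vpoly)"
  by unfold_locales (simp_all add: vp_scale_def vec_eq_iff smult_add_right smult_add_left)

text \<open>The convolution \<open>p * u = \<Sum>k. p(\<cdot> - k) u(k)\<close>, for a scalar polynomial and a sequence of row
  vectors, and for a row vector of polynomials and a sequence of matrices.\<close>

definition pconv :: "complex poly \<Rightarrow> (int \<Rightarrow> complex^'r) \<Rightarrow> 'r::finite vpoly" where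
  "pconv p u = Sum_any (\<lambda>k. \<chi> i. smult (u k $ i) (p \<circ>\<^sub>p [:- of_int k, 1:]))"

definition vpconv :: "'r::finite vpoly \<Rightarrow> (int \<Rightarrow> complex^'r^'r) \<Rightarrow> 'r vpoly" where
  "vpconv p u =
     Sum_any (\<lambda>k. \<chi> j. \<Sum>i\<in>UNIV. smult (u k $ i $ j) (p $ i \<circ>\<^sub>p [:- of_int k, 1:]))"

definition Pspace :: "nat \<Rightarrow> (int \<Rightarrow> complex^'r) \<Rightarrow> 'r::finite vpoly set" where
  "Pspace m v = {pconv p v | p. degree p \<le> m}"

definition eigenvalues_on ::
    "((int \<Rightarrow> complex^'r) \<Rightarrow> int \<Rightarrow> complex^'r) \<Rightarrow> (int \<Rightarrow> complex^'r) set \<Rightarrow> complex set" where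
  "eigenvalues_on T W = {l. \<exists>w\<in>W. w \<noteq> (\<lambda>_. 0) \<and> T w = (\<lambda>k. l *s w k)}"

definition sum_rules :: "nat \<Rightarrow> (int \<Rightarrow> complex^'r^'r) \<Rightarrow> (int \<Rightarrow> complex^'r) \<Rightarrow> bool" where
  "sum_rules n a u \<longleftrightarrow>
     eq_upto_O n (\<lambda>\<xi>. vsymbol u (2 * \<xi>) v* msymbol a \<xi>) (\<lambda>\<xi>. vsymbol u \<xi>) \<and>
     eq_upto_O n (\<lambda>\<xi>. vsymbol u (2 * \<xi>) v* msymbol a (\<xi> + pi)) (\<lambda>\<xi>. 0)"

text \<open>\<open>sum_rule_vector m a v u\<close>: the finitely supported sequence \<open>u\<close> has symbol \<open>d v\<close> (as symbols)
  for some finitely supported \<open>d\<close> with symbol \<open>1\<close> at \<open>0\<close>, and \<open>a\<close> has order \<open>m + 1\<close> sum rules with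
  respect to \<open>u\<close>.\<close>

definition sum_rule_vector ::
    "nat \<Rightarrow> (int \<Rightarrow> complex^'r^'r) \<Rightarrow> (int \<Rightarrow> complex^'r) \<Rightarrow> (int \<Rightarrow> complex^'r) \<Rightarrow> bool" where
  "sum_rule_vector m a v u \<longleftrightarrow>
     (\<exists>d. fin_supp d \<and> symbol d 0 = 1 \<and> fin_supp u \<and>
          (\<forall>\<xi>. vsymbol u \<xi> = symbol d \<xi> *s vsymbol v \<xi>) \<and>
          sum_rules (m + 1) a u)"

end

theory Submission
  imports Defs "HOL-Complex_Analysis.Laurent_Convergence"
begin

unbundle no Formal_Power_Series.fps_syntax

text \<open>
  Put \<open>X = \<i>\<xi>\<close>. The Taylor series of the symbol of \<open>w\<close> is \<open>\<Sum>k. w(k) exp(- k X)\<close>, and by Taylor's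
  formula convolving a polynomial with \<open>w\<close> is applying this series to it with \<open>X\<close> acting as the
  derivative. Splitting \<open>\<Sum>k. w(k) a(j - 2k)\<close> by the parity of \<open>j\<close> shows that \<open>S\<^sub>a(q * v)\<close> is a
  polynomial iff \<open>v(2X) a\<^sub>\<pi>(X)\<close> kills \<open>q(\<cdot>/2)\<close>, where \<open>a\<^sub>\<pi>(k) = (-1)\<^sup>k a(k)\<close>, and that it then is
  \<open>v(2X) a(X)\<close> applied to \<open>q(\<cdot>/2)\<close>. A polynomial of degree exactly \<open>m\<close> is a cyclic vector whose
  annihilator is \<open>(X\<^sup>m\<^sup>+\<^sup>1)\<close>. So if \<open>S\<^sub>a\<close> maps \<open>q * v\<close> into \<open>\<P>\<^sub>m\<^sub>,\<^sub>v\<close> for a single \<open>q\<close> of degree \<open>m\<close>,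
  then \<open>v(2X) a(X) = c(X) v(X)\<close> and \<open>v(2X) a\<^sub>\<pi>(X) = 0\<close> modulo \<open>X\<^sup>m\<^sup>+\<^sup>1\<close> for some \<open>c\<close>, and each of
  the six items is equivalent to these congruences with \<open>c(0) = 1\<close>: the normalisation follows from a
  fixed constant sequence, from the spectrum, or from a leading coefficient. Item (4) amounts to
  solving \<open>d(2X) c(X) = d(X)\<close>.
\<close>

section \<open>Power series acting on polynomials by differentiation\<close>

text \<open>The series \<open>f\<close> evaluated at the derivation \<open>pderiv\<close>. Stopping
  at \<open>degree q\<close> loses nothing, since higher derivatives vanish.\<close>

definition act :: "complex fps \<Rightarrow> complex poly \<Rightarrow> complex poly" where
  "act f q = (\<Sum>n\<le>degree q. smult (fps_nth f n) ((pderiv ^^ n) q))"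

lemma higher_pderiv_eq_0:
  fixes q :: "complex poly"
  assumes "degree q < n"
  shows "(pderiv ^^ n) q = 0"
  using assms by (intro poly_eqI) (simp add: coeff_higher_pderiv coeff_eq_0)

text \<open>Gives polynomials of different degrees a common range of summation.\<close>

lemma act_bound:
  assumes "degree q \<le> N"
  shows "act f q = (\<Sum>n\<le>N. smult (fps_nth f n) ((pderiv ^^ n) q))"
  unfolding act_def using assms
  by (intro sum.mono_neutral_left) (auto simp: higher_pderiv_eq_0)

lemma smult_sum_right: "smult c (\<Sum>i\<in>A. p i) = (\<Sum>i\<in>A. smult c (p i))"
  by (induction A rule: infinite_finite_induct) (simp_all add: smult_add_right)

lemma act_0_right [simp]: "act f 0 = 0"
  by (simp add: act_def)

lemma act_0_left [simp]: "act 0 q = 0"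
  by (simp add: act_def)

lemma act_add_right: "act f (p + q) = act f p + act f q"
proof -
  define N where "N = max (degree p) (degree q)"
  have "degree p \<le> N" "degree q \<le> N" "degree (p + q) \<le> N"
    by (auto simp: N_def degree_add_le)
  then show ?thesis
    by (simp add: act_bound[where N = N] higher_pderiv_add smult_add_right sum.distrib)
qed

lemma act_smult_right: "act f (smult c p) = smult c (act f p)"
proof -
  have "degree (smult c p) \<le> degree p" by simp
  then show ?thesis
    by (simp add: act_bound[where N = "degree p"] higher_pderiv_smult smult_sum_right mult.commute)
qed

lemma act_sum_right: "act f (\<Sum>i\<in>A. p i) = (\<Sum>i\<in>A. act f (p i))"
  by (induction A rule: infinite_finite_induct) (simp_all add: act_add_right)

lemma act_add_left: "act (f + g) q = act f q + act g q"
  by (simp add: act_def smult_add_left sum.distrib)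

lemma act_sum_left: "act (\<Sum>i\<in>A. f i) q = (\<Sum>i\<in>A. act (f i) q)"
  by (induction A rule: infinite_finite_induct) (simp_all add: act_add_left)

lemma act_const: "act (fps_const c) q = smult c q"
proof -
  have "act (fps_const c) q = (\<Sum>n\<le>degree q. if n = 0 then smult c q else 0)"
    unfolding act_def by (intro sum.cong) auto
  then show ?thesis by simp
qed

lemma act_1 [simp]: "act 1 q = q"
  using act_const[of 1 q] by simp

lemma act_fps_const_mult: "act (fps_const c * f) q = smult c (act f q)"
  by (simp add: act_def smult_sum_right)

lemma degree_act_le: "degree (act f q) \<le> degree q"
  unfolding act_def
  by (intro degree_sum_le) (auto intro!: order.trans[OF degree_smult_le] simp: degree_higher_pderiv)

lemma act_pderiv: "act f (pderiv q) = pderiv (act f q)"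
proof -
  have "act f (pderiv q) = (\<Sum>n\<le>degree q. smult (fps_nth f n) ((pderiv ^^ n) (pderiv q)))"
    by (rule act_bound) (simp add: degree_pderiv)
  also have "\<dots> = (\<Sum>n\<le>degree q. pderiv (smult (fps_nth f n) ((pderiv ^^ n) q)))"
    by (simp add: pderiv_smult flip: funpow_swap1)
  also have "\<dots> = pderiv (act f q)"
    by (simp add: act_def higher_pderiv_sum[where n = 1, simplified])
  finally show ?thesis .
qed

lemma act_higher_pderiv: "act f ((pderiv ^^ n) q) = (pderiv ^^ n) (act f q)"
  by (induction n) (simp_all add: act_pderiv)

text \<open>Cauchy product. It makes the polynomials a module over the power series ring, so that
  units of that ring act invertibly.\<close>

lemma act_mult: "act (f * g) q = act f (act g q)"
proof -
  define N where "N = degree q"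
  let ?t = "\<lambda>n k. smult (fps_nth f n * fps_nth g k) ((pderiv ^^ (n + k)) q)"
  have "act f (act g q) = (\<Sum>k\<le>N. smult (fps_nth g k) (act f ((pderiv ^^ k) q)))"
    unfolding act_def[of g] N_def by (simp add: act_sum_right act_smult_right)
  also have "\<dots> = (\<Sum>k\<le>N. \<Sum>n\<le>N. ?t n k)"
  proof (intro sum.cong refl)
    fix k
    have "act f ((pderiv ^^ k) q) = (\<Sum>n\<le>N. smult (fps_nth f n) ((pderiv ^^ n) ((pderiv ^^ k) q)))"
      by (rule act_bound) (simp add: N_def degree_higher_pderiv)
    then show "smult (fps_nth g k) (act f ((pderiv ^^ k) q)) = (\<Sum>n\<le>N. ?t n k)"
      by (simp add: smult_sum_right funpow_add mult.commute)
  qed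
  also have "\<dots> = (\<Sum>n\<le>N. \<Sum>k\<le>N. ?t n k)"
    by (rule sum.swap)
  also have "\<dots> = (\<Sum>(n,k)\<in>{..N} \<times> {..N}. ?t n k)"
    by (simp add: sum.cartesian_product)
  \<comment> \<open>Off the triangle the order of differentiation exceeds the degree of
    \<open>q\<close>, so the square may be cut down to it.\<close>
  also have "\<dots> = (\<Sum>(n,k)\<in>{(i,j). i + j \<le> N}. ?t n k)"
    by (rule sum.mono_neutral_right) (auto simp: N_def, metis higher_pderiv_eq_0 not_le)
  also have "\<dots> = (\<Sum>k\<le>N. \<Sum>i\<le>k. ?t i (k - i))"
    by (rule sum.triangle_reindex_eq)
  also have "\<dots> = act (f * g) q"
    by (simp add: act_def N_def fps_mult_nth atLeast0AtMost smult_sum)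
  finally show ?thesis by simp
qed

lemma poly_eq_if_pderiv_eq:
  fixes p q :: "complex poly"
  assumes "pderiv p = pderiv q" "poly p 0 = poly q 0"
  shows "p = q"
proof -
  have "pderiv (p - q) = 0" using assms by (simp add: pderiv_diff)
  then obtain h where h: "p - q = [:h:]" using pderiv_iszero by blast
  then have "poly (p - q) 0 = h" by simp
  with assms have "h = 0" by simp
  with h show ?thesis by simp
qed

text \<open>Taylor's formula. By induction on the degree both sides have the same derivative, so it
  remains to compare them at \<open>0\<close>.\<close>

lemma act_fps_exp: "act (fps_exp c) q = q \<circ>\<^sub>p [:c, 1:]"
proof (induction "degree q" arbitrary: q rule: less_induct)
  case less
  show ?case
  proof (cases "degree q = 0")
    case True
    then obtain h where "q = [:h:]" by (rule degree_eq_zeroE)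
    then show ?thesis by (simp add: act_def)
  next
    case False
    show ?thesis
    proof (rule poly_eq_if_pderiv_eq)
      have "degree (pderiv q) < degree q" using False by (simp add: degree_pderiv)
      then have "act (fps_exp c) (pderiv q) = pderiv q \<circ>\<^sub>p [:c, 1:]"
        by (rule less)
      then show "pderiv (act (fps_exp c) q) = pderiv (q \<circ>\<^sub>p [:c, 1:])"
        by (simp add: act_pderiv pderiv_pcompose pderiv_pCons)
      \<comment> \<open>At \<open>0\<close> the \<open>n\<close>-th derivative of \<open>q\<close>
        is \<open>n!\<close> times its \<open>n\<close>-th coefficient, so the left side is the sum
        of the \<open>coeff q n * c ^ n\<close>, which is \<open>poly q c\<close>.\<close>
      show "poly (act (fps_exp c) q) 0 = poly (q \<circ>\<^sub>p [:c, 1:]) 0"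
        by (simp add: act_def poly_pcompose poly_sum poly_0_coeff_0 coeff_higher_pderiv coeff_sum
            poly_altdef[of q] pochhammer_fact[symmetric] mult.commute)
    qed
  qed
qed

section \<open>Dilation of series and rescaling of polynomials\<close>

abbreviation (input) dil :: "complex fps \<Rightarrow> complex fps" where
  "dil f \<equiv> f oo (fps_const 2 * fps_X)"

abbreviation (input) half :: "complex poly \<Rightarrow> complex poly" where
  "half q \<equiv> q \<circ>\<^sub>p [:0, 1/2:]"

lemma higher_pderiv_half: "(pderiv ^^ n) (half q) = smult (1 / 2 ^ n) (half ((pderiv ^^ n) q))"
  by (induction n) (simp_all add: pderiv_smult pderiv_pcompose pderiv_pCons mult.commute)

lemma degree_half [simp]: "degree (half q) = degree q"
  by (simp add: degree_pcompose)

lemma half_eq_0_iff [simp]: "half q = 0 \<longleftrightarrow> q = 0"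
  by (simp add: pcompose_eq_0_iff)

text \<open>Every derivative of \<open>half q\<close> brings out a factor \<open>1/2\<close>; the
  factors \<open>2 ^ n\<close> in the coefficients of \<open>dil f\<close> cancel these.\<close>

lemma half_act: "half (act f q) = act (dil f) (half q)"
  by (simp add: act_def pcompose_sum pcompose_smult higher_pderiv_half)

section \<open>Divided powers x^m / m! and how series act on them\<close>

definition epoly :: "nat \<Rightarrow> complex poly" where
  "epoly m = monom (1 / fact m) m"

lemma degree_epoly [simp]: "degree (epoly m) = m"
  by (simp add: epoly_def degree_monom_eq)

lemma epoly_nonzero [simp]: "epoly m \<noteq> 0"
  by (simp add: epoly_def)

lemma higher_pderiv_epoly:
  assumes "n \<le> m"
  shows "(pderiv ^^ n) (epoly m) = epoly (m - n)"
proof (rule poly_eqI)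
  fix k
  have "pochhammer (1 + of_nat k) n * fact k = (fact (n + k) :: complex)"
    using pochhammer_product'[of "1 :: complex" k n] by (simp add: pochhammer_fact add.commute)
  then show "coeff ((pderiv ^^ n) (epoly m)) k = coeff (epoly (m - n)) k"
    using assms by (auto simp: epoly_def coeff_higher_pderiv field_simps)
qed

lemma half_epoly: "half (epoly m) = smult (1 / 2 ^ m) (epoly m)"
  by (rule poly_eqI) (auto simp: epoly_def coeff_pcompose_linear power_one_over)

lemma act_epoly: "act f (epoly m) = (\<Sum>n\<le>m. smult (fps_nth f n) (epoly (m - n)))"
  by (simp add: act_def higher_pderiv_epoly)

text \<open>Up to factorials the result has the coefficients of \<open>f\<close> in reverse order,
  so \<open>f\<close> modulo X^(m+1) can be read off. Inverting the formula gives
  \<open>act_epoly_surj\<close>.\<close>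

lemma coeff_act_epoly:
  "coeff (act f (epoly m)) k = (if k \<le> m then fps_nth f (m - k) / fact k else 0)"
proof -
  have "coeff (act f (epoly m)) k = (\<Sum>n\<le>m. if m - n = k then fps_nth f n / fact k else 0)"
    unfolding act_epoly coeff_sum by (auto simp: epoly_def intro!: sum.cong)
  also have "\<dots> = (\<Sum>n\<le>m. if n = m - k then (if k \<le> m then fps_nth f n / fact k else 0) else 0)"
    by (intro sum.cong) auto
  finally show ?thesis by simp
qed

lemma act_epoly_surj:
  assumes "degree q \<le> m"
  shows "act (Abs_fps (\<lambda>n. coeff q (m - n) * fact (m - n))) (epoly m) = q"
  using assms by (intro poly_eqI) (auto simp: coeff_act_epoly coeff_eq_0)

section \<open>Congruence modulo X^(m+1), cyclic vectors and annihilators\<close>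

definition fps_eq_upto :: "nat \<Rightarrow> complex fps \<Rightarrow> complex fps \<Rightarrow> bool" where
  "fps_eq_upto m f g \<longleftrightarrow> (\<forall>n\<le>m. fps_nth f n = fps_nth g n)"

lemma fps_eq_upto_refl [simp]: "fps_eq_upto m f f"
  by (simp add: fps_eq_upto_def)

lemma fps_eq_upto_sym: "fps_eq_upto m f g \<Longrightarrow> fps_eq_upto m g f"
  by (simp add: fps_eq_upto_def)

lemma fps_eq_upto_trans [trans]: "fps_eq_upto m f g \<Longrightarrow> fps_eq_upto m g h \<Longrightarrow> fps_eq_upto m f h"
  by (simp add: fps_eq_upto_def)

lemma fps_eq_upto_mult:
  "fps_eq_upto m f f' \<Longrightarrow> fps_eq_upto m g g' \<Longrightarrow> fps_eq_upto m (f * g) (f' * g')"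
  by (auto simp: fps_eq_upto_def fps_mult_nth intro!: sum.cong)

lemma fps_eq_upto_mult_unit_iff:
  assumes "fps_nth h 0 \<noteq> 0"
  shows "fps_eq_upto m (h * f) (h * g) \<longleftrightarrow> fps_eq_upto m f g"
proof
  have cancel: "inverse h * (h * x) = x" for x
    using assms by (simp add: inverse_mult_eq_1 flip: mult.assoc)
  assume "fps_eq_upto m (h * f) (h * g)"
  then have "fps_eq_upto m (inverse h * (h * f)) (inverse h * (h * g))"
    by (rule fps_eq_upto_mult[OF fps_eq_upto_refl])
  then show "fps_eq_upto m f g"
    by (simp only: cancel)
qed (auto intro: fps_eq_upto_mult)

lemma fps_eq_upto_dil: "fps_eq_upto m f g \<Longrightarrow> fps_eq_upto m (dil f) (dil g)"
  by (simp add: fps_eq_upto_def)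

lemma act_cong:
  assumes "fps_eq_upto m f g" "degree q \<le> m"
  shows "act f q = act g q"
  using assms by (auto simp: act_def fps_eq_upto_def intro!: sum.cong)

text \<open>The series supplied by \<open>act_epoly_surj\<close> is a unit: its constant term is
  \<open>m!\<close> times the leading coefficient of \<open>q\<close>.\<close>

lemma act_cyclic:
  assumes "degree q = m" "q \<noteq> 0"
  obtains g where "fps_nth g 0 \<noteq> 0" "q = act g (epoly m)"
proof
  show "q = act (Abs_fps (\<lambda>n. coeff q (m - n) * fact (m - n))) (epoly m)"
    using act_epoly_surj[of q m] assms by simp
qed (use assms in auto)

text \<open>Write both polynomials as images of \<open>epoly m\<close> and divide by the unit that
  belongs to \<open>q\<close>.\<close>

lemma act_surj:
  assumes "degree q = m" "q \<noteq> 0" "degree q1 \<le> m"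
  obtains c where "q1 = act c q"
proof -
  obtain g where g: "fps_nth g 0 \<noteq> 0" "q = act g (epoly m)"
    using act_cyclic assms by blast
  obtain c where c: "q1 = act c (epoly m)"
    using act_epoly_surj[OF assms(3)] by metis
  have "q1 = act (c * inverse g) q"
    by (simp add: c g(2) mult.assoc inverse_mult_eq_1 g(1) flip: act_mult)
  then show ?thesis using that by blast
qed

text \<open>The annihilator of a polynomial of degree exactly \<open>m\<close> is the ideal
  generated by X^(m+1). For \<open>epoly m\<close> this is \<open>coeff_act_epoly\<close>; a general
  \<open>q\<close> differs from it by a unit, which cancels.\<close>

lemma act_eq_iff:
  assumes "degree q = m" "q \<noteq> 0"
  shows "act f q = act g q \<longleftrightarrow> fps_eq_upto m f g"
proof
  assume eq: "act f q = act g q"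
  obtain h where h: "fps_nth h 0 \<noteq> 0" "q = act h (epoly m)"
    using act_cyclic assms by blast
  have "act (h * f) (epoly m) = act (h * g) (epoly m)"
    using eq by (simp add: h(2) mult.commute flip: act_mult)
  then have "coeff (act (h * f) (epoly m)) (m - n) = coeff (act (h * g) (epoly m)) (m - n)" for n
    by simp
  then have "fps_eq_upto m (h * f) (h * g)"
    by (simp add: coeff_act_epoly fps_eq_upto_def) (metis diff_diff_cancel)
  then show "fps_eq_upto m f g"
    using fps_eq_upto_mult_unit_iff h(1) by blast
qed (use assms act_cong in auto)

text \<open>Derivatives of positive order have smaller degree, so only the constant term of
  \<open>f\<close> reaches the top coefficient.\<close>

lemma coeff_degree_act: "coeff (act f q) (degree q) = fps_nth f 0 * coeff q (degree q)"
proof -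
  have "coeff (act f q) (degree q) = (\<Sum>n\<le>degree q. if n = 0 then fps_nth f 0 * coeff q (degree q) else 0)"
    unfolding act_def coeff_sum
    by (intro sum.cong refl) (auto simp: coeff_higher_pderiv coeff_eq_0)
  then show ?thesis by simp
qed

section \<open>Taylor series of symbols\<close>

text \<open>The witness \<open>g\<close> is entire and is restricted to the imaginary axis:
  substituting X = i xi keeps powers of \<open>\<i>\<close> out of the coefficients of
  \<open>F\<close>, and holomorphy provides real derivatives of all orders.\<close>

definition expands :: "(real \<Rightarrow> complex) \<Rightarrow> complex fps \<Rightarrow> bool" where
  "expands f F \<longleftrightarrow>
     (\<exists>g. g holomorphic_on UNIV \<and> g has_fps_expansion F \<and> (\<forall>\<xi>. f \<xi> = g (\<i> * of_real \<xi>)))"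

text \<open>\<open>vector_derivative\<close> is unspecified where no derivative exists; this
  guarantees that iterated derivatives have their usual meaning.\<close>

definition rsmooth :: "(real \<Rightarrow> 'a::real_normed_vector) \<Rightarrow> bool" where
  "rsmooth f \<longleftrightarrow> (\<forall>n x. nth_deriv n f differentiable (at x))"

lemma nth_deriv_0 [simp]: "nth_deriv 0 f = f"
  by (simp add: nth_deriv_def)

lemma nth_deriv_Suc: "nth_deriv (Suc n) f = (\<lambda>x. vector_derivative (nth_deriv n f) (at x))"
  by (simp add: nth_deriv_def)

text \<open>Chain rule along the imaginary axis: each real derivative contributes one factor
  \<open>\<i>\<close>.\<close>

lemma expands_derivs:
  assumes "expands f F"
  shows "rsmooth f" "nth_deriv n f 0 = \<i> ^ n * fact n * fps_nth F n"
proof -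
  obtain g where g: "g holomorphic_on UNIV" "g has_fps_expansion F" "\<And>\<xi>. f \<xi> = g (\<i> * of_real \<xi>)"
    using assms by (auto simp: expands_def)
  have hvd: "((\<lambda>\<xi>. \<i> ^ n * (deriv ^^ n) g (\<i> * of_real \<xi>)) has_vector_derivative
           \<i> ^ Suc n * (deriv ^^ Suc n) g (\<i> * of_real x)) (at x)" for n x
  proof -
    have "((\<lambda>\<xi>::real. \<i> * of_real \<xi>) has_vector_derivative \<i> * 1) (at x)"
      by (auto intro!: derivative_eq_intros simp: has_vector_derivative_def scaleR_conv_of_real mult.commute)
    moreover have "((deriv ^^ n) g has_field_derivative deriv ((deriv ^^ n) g) (\<i> * of_real x)) (at (\<i> * of_real x))"
      by (rule holomorphic_derivI[of _ UNIV]) (use g(1) in \<open>auto intro: holomorphic_higher_deriv\<close>)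
    ultimately have "((deriv ^^ n) g \<circ> (\<lambda>\<xi>::real. \<i> * of_real \<xi>) has_vector_derivative
        (\<i> * 1) * deriv ((deriv ^^ n) g) (\<i> * of_real x)) (at x)"
      by (rule field_vector_diff_chain_at)
    from has_vector_derivative_mult_right[OF this, of "\<i> ^ n"] show ?thesis
      by (simp add: o_def mult_ac)
  qed
  have nd: "nth_deriv n f = (\<lambda>\<xi>. \<i> ^ n * (deriv ^^ n) g (\<i> * of_real \<xi>))" for n
  proof (induction n)
    case (Suc n)
    show ?case unfolding nth_deriv_Suc Suc using vector_derivative_at[OF hvd] by fast
  qed (simp add: g(3))
  show "rsmooth f" unfolding rsmooth_def nd using hvd by (meson differentiableI_vector)
  show "nth_deriv n f 0 = \<i> ^ n * fact n * fps_nth F n"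
    using fps_nth_fps_expansion[OF g(2), of n] by (simp add: nd)
qed

lemma expands_unique: "expands f F \<Longrightarrow> expands f G \<Longrightarrow> F = G"
  by (rule fps_ext) (metis expands_derivs(2) mult_cancel_left fact_nonzero power_not_zero complex_i_not_zero no_zero_divisors)

lemma expands_mult: "expands f F \<Longrightarrow> expands g G \<Longrightarrow> expands (\<lambda>\<xi>. f \<xi> * g \<xi>) (F * G)"
  unfolding expands_def
  apply clarify
  subgoal for g1 g2
    by (rule exI[of _ "\<lambda>z. g1 z * g2 z"]) (auto intro!: holomorphic_on_mult has_fps_expansion_mult)
  done

lemma expands_0: "expands (\<lambda>_. 0) 0"
  unfolding expands_def by (rule exI[of _ "\<lambda>_. 0"]) auto

lemma expands_sum:
  assumes "\<And>i. i \<in> A \<Longrightarrow> expands (f i) (F i)"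
  shows "expands (\<lambda>\<xi>. \<Sum>i\<in>A. f i \<xi>) (\<Sum>i\<in>A. F i)"
proof -
  obtain g where g: "\<And>i. i \<in> A \<Longrightarrow> g i holomorphic_on UNIV \<and> g i has_fps_expansion F i \<and>
      (\<forall>\<xi>. f i \<xi> = g i (\<i> * of_real \<xi>))"
    using assms unfolding expands_def by metis
  show ?thesis unfolding expands_def
    by (rule exI[of _ "\<lambda>z. \<Sum>i\<in>A. g i z"])
       (use g in \<open>auto intro!: holomorphic_on_sum has_fps_expansion_sum sum.cong\<close>)
qed

lemma expands_exp: "expands (\<lambda>\<xi>. c * exp (- (\<i> * of_int k * of_real \<xi>))) (fps_const c * fps_exp (- of_int k))"
  unfolding expands_def
  by (intro exI[of _ "\<lambda>z. c * exp (- of_int k * z)"] conjI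
      has_fps_expansion_cmult_left has_fps_expansion_exp)
    (auto intro!: holomorphic_intros simp: mult_ac)

lemma expands_double:
  assumes "expands f F"
  shows "expands (\<lambda>\<xi>. f (2 * \<xi>)) (dil F)"
proof -
  obtain g where g: "g holomorphic_on UNIV" "g has_fps_expansion F" "\<And>\<xi>. f \<xi> = g (\<i> * of_real \<xi>)"
    using assms by (auto simp: expands_def)
  have "(g \<circ> (\<lambda>z. 2 * z)) holomorphic_on UNIV"
    by (rule holomorphic_on_compose_gen[where t = UNIV]) (auto intro!: holomorphic_intros g(1))
  moreover have "(g \<circ> (\<lambda>z. 2 * z)) has_fps_expansion dil F"
    by (rule has_fps_expansion_compose[OF g(2)])
       (auto intro!: has_fps_expansion_cmult_left has_fps_expansion_fps_X)
  ultimately show ?thesis unfolding expands_def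
    by (intro exI[of _ "g \<circ> (\<lambda>z. 2 * z)"]) (auto simp: g(3) mult_ac)
qed

section \<open>Derivatives of vector-valued functions, taken componentwise\<close>

lemma has_vector_derivative_vec:
  fixes f :: "real \<Rightarrow> 'a::real_normed_vector ^ 'n"
  assumes "\<And>i. ((\<lambda>x. f x $ i) has_vector_derivative D $ i) (at x)"
  shows "(f has_vector_derivative D) (at x)"
  using assms unfolding has_vector_derivative_def has_derivative_def
  by (auto intro!: vec_tendstoI bounded_linear_scaleR_left)

lemma nth_deriv_vec:
  fixes f :: "real \<Rightarrow> 'a::real_normed_vector ^ 'n"
  assumes "\<And>i. rsmooth (\<lambda>\<xi>. f \<xi> $ i)"
  shows "nth_deriv n f x $ i = nth_deriv n (\<lambda>\<xi>. f \<xi> $ i) x" "rsmooth f"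
proof -
  have hvd: "((\<lambda>x. \<chi> i. nth_deriv n (\<lambda>\<xi>. f \<xi> $ i) x) has_vector_derivative
       (\<chi> i. nth_deriv (Suc n) (\<lambda>\<xi>. f \<xi> $ i) x)) (at x)" for n x
    by (rule has_vector_derivative_vec)
       (use assms in \<open>simp add: rsmooth_def nth_deriv_Suc vector_derivative_works\<close>)
  have nd: "nth_deriv n f = (\<lambda>x. \<chi> i. nth_deriv n (\<lambda>\<xi>. f \<xi> $ i) x)" for n
  proof (induction n)
    case (Suc n)
    show ?case unfolding nth_deriv_Suc[of n f] Suc using vector_derivative_at[OF hvd] by fast
  qed simp
  show "nth_deriv n f x $ i = nth_deriv n (\<lambda>\<xi>. f \<xi> $ i) x" by (simp add: nd)
  show "rsmooth f" unfolding rsmooth_def nd using hvd by (meson differentiableI_vector)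
qed

text \<open>The factors \<open>\<i> ^ j * fact j\<close> between derivatives and coefficients are
  nonzero and the same on both sides, so they cancel.\<close>

lemma eq_upto_O_expands:
  fixes f g :: "real \<Rightarrow> complex ^ 'n"
  assumes "\<And>i. expands (\<lambda>\<xi>. f \<xi> $ i) (F i)" "\<And>i. expands (\<lambda>\<xi>. g \<xi> $ i) (G i)"
  shows "eq_upto_O (m + 1) f g \<longleftrightarrow> (\<forall>i. fps_eq_upto m (F i) (G i))"
proof -
  have "nth_deriv j f 0 = nth_deriv j g 0 \<longleftrightarrow> (\<forall>i. fps_nth (F i) j = fps_nth (G i) j)" for j
    by (simp add: vec_eq_iff nth_deriv_vec(1) expands_derivs(1)[OF assms(1)]
        expands_derivs(1)[OF assms(2)] expands_derivs(2)[OF assms(1)] expands_derivs(2)[OF assms(2)])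
  then show ?thesis by (auto simp: eq_upto_O_def fps_eq_upto_def less_Suc_eq_le)
qed

section \<open>Series of the symbols of finitely supported sequences\<close>

definition seq_fps :: "(int \<Rightarrow> complex) \<Rightarrow> complex fps" where
  "seq_fps w = Sum_any (\<lambda>k. fps_const (w k) * fps_exp (- of_int k))"

lemma seq_fps_eq_sum:
  assumes "finite K" "\<And>k. k \<notin> K \<Longrightarrow> w k = 0"
  shows "seq_fps w = (\<Sum>k\<in>K. fps_const (w k) * fps_exp (- of_int k))"
  unfolding seq_fps_def using assms by (intro Sum_any.expand_superset) auto

lemma symbol_eq_sum:
  assumes "finite K" "\<And>k. k \<notin> K \<Longrightarrow> w k = 0"
  shows "symbol w \<xi> = (\<Sum>k\<in>K. w k * exp (- (\<i> * of_int k * of_real \<xi>)))"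
  unfolding symbol_def using assms by (intro Sum_any.expand_superset) auto

lemma expands_symbol:
  assumes "fin_supp w"
  shows "expands (symbol w) (seq_fps w)"
proof -
  have fin: "finite {k. w k \<noteq> 0}" using assms by (simp add: fin_supp_def)
  have "symbol w = (\<lambda>\<xi>. \<Sum>k\<in>{k. w k \<noteq> 0}. w k * exp (- (\<i> * of_int k * of_real \<xi>)))"
    using symbol_eq_sum[OF fin] by auto
  moreover have "seq_fps w = (\<Sum>k\<in>{k. w k \<noteq> 0}. fps_const (w k) * fps_exp (- of_int k))"
    by (rule seq_fps_eq_sum[OF fin]) auto
  ultimately show ?thesis by (simp only:) (intro expands_sum expands_exp)
qed

lemma fin_supp_nth:
  fixes v :: "int \<Rightarrow> 'a::zero ^ 'n"
  shows "fin_supp v \<Longrightarrow> fin_supp (\<lambda>k. v k $ i)"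
  unfolding fin_supp_def by (erule rev_finite_subset) auto

lemma seq_fps_nth_0: "fin_supp w \<Longrightarrow> fps_nth (seq_fps w) 0 = symbol w 0"
  using expands_derivs(2)[OF expands_symbol, of w 0] by simp

text \<open>Shifting the argument of a symbol by \<open>pi\<close> multiplies its
  \<open>k\<close>-th exponential by (-1)^k. Thus the expansion of the symbol of \<open>a\<close> at
  \<open>pi\<close> becomes one at \<open>0\<close>.\<close>

definition alt :: "(int \<Rightarrow> complex^'r^'s) \<Rightarrow> int \<Rightarrow> complex^'r^'s" where
  "alt a k = (if even k then a k else - a k)"

lemma fin_supp_alt: "fin_supp a \<Longrightarrow> fin_supp (alt a)"
  unfolding fin_supp_def by (erule rev_finite_subset) (auto simp: alt_def)

lemma exp_int_pi: "exp (- (\<i> * of_int k * of_real pi)) = (if even k then 1 else - 1)"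
proof -
  have "exp (- (\<i> * of_int k * of_real pi)) = cis (- (of_int k * pi))"
    by (simp add: cis_conv_exp mult_ac)
  also have "\<dots> = (if even k then 1 else - 1)"
    by (auto simp: complex_eq_iff mult.commute[of _ pi] )
  finally show ?thesis .
qed

lemma msymbol_shift: "msymbol a (\<xi> + pi) = msymbol (alt a) \<xi>"
proof -
  have "symbol (\<lambda>k. a k $ i $ j) (\<xi> + pi) = symbol (\<lambda>k. alt a k $ i $ j) \<xi>" for i j
    unfolding symbol_def
  proof (rule Sum_any.cong)
    fix k
    have "exp (- (\<i> * of_int k * of_real (\<xi> + pi))) =
        exp (- (\<i> * of_int k * of_real \<xi>)) * exp (- (\<i> * of_int k * of_real pi))"
      by (simp add: algebra_simps flip: exp_add)
    then show "a k $ i $ j * exp (- (\<i> * of_int k * of_real (\<xi> + pi))) =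
        alt a k $ i $ j * exp (- (\<i> * of_int k * of_real \<xi>))"
      by (simp add: exp_int_pi alt_def)
  qed
  then show ?thesis by (simp add: msymbol_def vec_eq_iff)
qed

section \<open>Convolution of sequences and products of symbols\<close>

definition cconv :: "(int \<Rightarrow> complex) \<Rightarrow> (int \<Rightarrow> complex) \<Rightarrow> int \<Rightarrow> complex" where
  "cconv d w n = (\<Sum>k | d k \<noteq> 0. d k * w (n - k))"

lemma cconv_outside:
  assumes "n \<notin> (\<lambda>(k,l). k + l) ` ({k. d k \<noteq> 0} \<times> K)" "\<And>k. k \<notin> K \<Longrightarrow> w k = 0"
  shows "cconv d w n = 0"
  unfolding cconv_def
proof (rule sum.neutral, safe)
  fix k assume k: "d k \<noteq> 0"
  have "n - k \<notin> K"
  proof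
    assume "n - k \<in> K"
    then have "n \<in> (\<lambda>(k,l). k + l) ` ({k. d k \<noteq> 0} \<times> K)"
      using k by (intro image_eqI[of _ _ "(k, n - k)"]) auto
    with assms show False by blast
  qed
  then show "d k * w (n - k) = 0" using assms by simp
qed

lemma symbol_cconv:
  assumes "fin_supp d" "fin_supp w"
  shows "fin_supp (cconv d w)" "symbol (cconv d w) \<xi> = symbol d \<xi> * symbol w \<xi>"
proof -
  let ?E = "\<lambda>k. exp (- (\<i> * of_int k * of_real \<xi>))"
  define D where "D = {k. d k \<noteq> 0}"
  define K where "K = {k. w k \<noteq> 0}"
  define N where "N = (\<lambda>(k,l). k + l) ` (D \<times> K)"
  have fin: "finite D" "finite K" "finite N" using assms by (auto simp: D_def K_def N_def fin_supp_def)
  have out: "cconv d w n = 0" if "n \<notin> N" for n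
    by (rule cconv_outside) (use that in \<open>auto simp: N_def K_def D_def\<close>)
  show "fin_supp (cconv d w)"
    unfolding fin_supp_def by (rule finite_subset[OF _ fin(3)]) (use out in auto)
  have inner: "(\<Sum>n\<in>N. w (n - k) * ?E n) = ?E k * symbol w \<xi>" if "k \<in> D" for k
  proof -
    have "(\<Sum>n\<in>N. w (n - k) * ?E n) = (\<Sum>n\<in>(+) k ` K. w (n - k) * ?E n)"
      by (rule sum.mono_neutral_right)
         (use fin that in \<open>auto simp: N_def K_def image_iff, metis add_diff_cancel_left' diff_add_cancel add.commute\<close>)
    also have "\<dots> = (\<Sum>l\<in>K. w l * ?E (k + l))"
      by (simp add: sum.reindex)
    also have "\<dots> = ?E k * (\<Sum>l\<in>K. w l * ?E l)"
      by (auto simp: sum_distrib_left algebra_simps intro!: sum.cong simp flip: exp_add)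
    also have "(\<Sum>l\<in>K. w l * ?E l) = symbol w \<xi>"
      by (rule symbol_eq_sum[symmetric]) (use fin in \<open>auto simp: K_def\<close>)
    finally show ?thesis .
  qed
  have "symbol (cconv d w) \<xi> = (\<Sum>n\<in>N. cconv d w n * ?E n)"
    by (rule symbol_eq_sum) (use fin out in auto)
  also have "\<dots> = (\<Sum>n\<in>N. \<Sum>k\<in>D. d k * (w (n - k) * ?E n))"
    by (simp add: cconv_def D_def sum_distrib_right mult.assoc)
  also have "\<dots> = (\<Sum>k\<in>D. d k * (\<Sum>n\<in>N. w (n - k) * ?E n))"
    by (subst sum.swap) (simp add: sum_distrib_left)
  also have "\<dots> = (\<Sum>k\<in>D. d k * ?E k * symbol w \<xi>)"
    by (intro sum.cong refl) (simp only: inner, simp only: mult.assoc)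
  also have "\<dots> = (\<Sum>k\<in>D. d k * ?E k) * symbol w \<xi>"
    by (simp add: sum_distrib_right)
  also have "(\<Sum>k\<in>D. d k * ?E k) = symbol d \<xi>"
    by (rule symbol_eq_sum[symmetric]) (use fin in \<open>auto simp: D_def\<close>)
  finally show "symbol (cconv d w) \<xi> = symbol d \<xi> * symbol w \<xi>" .
qed

text \<open>No coefficients are compared: both series expand the same product of symbols, and
  expansions are unique.\<close>

lemma seq_fps_cconv:
  assumes "fin_supp d" "fin_supp w"
  shows "seq_fps (cconv d w) = seq_fps d * seq_fps w"
proof (rule expands_unique)
  show "expands (symbol (cconv d w)) (seq_fps (cconv d w))"
    by (intro expands_symbol symbol_cconv assms)
  have "symbol (cconv d w) = (\<lambda>\<xi>. symbol d \<xi> * symbol w \<xi>)"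
    using symbol_cconv(2)[OF assms] by blast
  then show "expands (symbol (cconv d w)) (seq_fps d * seq_fps w)"
    using assms by (simp add: expands_mult expands_symbol)
qed

section \<open>Finitely supported sequences whose symbol has a prescribed Taylor polynomial\<close>

lemma fin_supp_add:
  fixes w w' :: "int \<Rightarrow> complex"
  assumes "fin_supp w" "fin_supp w'"
  shows "fin_supp (\<lambda>k. w k + w' k)" "seq_fps (\<lambda>k. w k + w' k) = seq_fps w + seq_fps w'"
proof -
  let ?K = "{k. w k \<noteq> 0} \<union> {k. w' k \<noteq> 0}"
  have fin: "finite ?K" using assms by (simp add: fin_supp_def)
  show "fin_supp (\<lambda>k. w k + w' k)"
    unfolding fin_supp_def by (rule finite_subset[OF _ fin]) auto
  show "seq_fps (\<lambda>k. w k + w' k) = seq_fps w + seq_fps w'"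
    by (subst (1 2 3) seq_fps_eq_sum[OF fin])
       (auto simp: sum.distrib fps_const_add[symmetric] distrib_right simp del: fps_const_add)
qed

lemma seq_fps_delta: "fin_supp (\<lambda>k. if k = n then c else 0)"
  "seq_fps (\<lambda>k. if k = n then c else 0) = fps_const c * fps_exp (- of_int n)"
  by (auto simp: fin_supp_def) (subst seq_fps_eq_sum[of "{n}"], auto)

text \<open>The unit impulse at \<open>0\<close> minus that at \<open>1\<close> has the series 1 -
  exp(-X); convolving with it repeatedly produces the powers.\<close>

lemma ex_seq_fps_diff_power:
  "\<exists>w. fin_supp w \<and> seq_fps w = fps_const c * (1 - fps_exp (- 1)) ^ n"
proof (induction n)
  case 0
  show ?case using seq_fps_delta[of 0 c] by auto
next
  case (Suc n)
  then obtain w where w: "fin_supp w" "seq_fps w = fps_const c * (1 - fps_exp (- 1)) ^ n" by blast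
  let ?d = "\<lambda>k::int. (if k = 0 then 1 else 0) + (if k = 1 then - 1 else 0 :: complex)"
  have "fin_supp ?d" "seq_fps ?d = 1 - fps_exp (- 1)"
    using fin_supp_add[OF seq_fps_delta(1) seq_fps_delta(1), of 0 1 1 "- 1"]
    by (auto simp: seq_fps_delta(2) simp flip: fps_const_neg)
  then show ?case
    using w symbol_cconv(1)[of ?d w] seq_fps_cconv[of ?d w] by (intro exI[of _ "cconv ?d w"]) (auto simp: mult_ac)
qed

text \<open>Since 1 - exp(-X) starts with X, its \<open>n\<close>-th power starts with X^n.\<close>

lemma fps_nth_one_minus_exp_power:
  "k \<le> n \<Longrightarrow> fps_nth ((1 - fps_exp (- 1 :: complex)) ^ n) k = (if k = n then 1 else 0)"
proof (induction n arbitrary: k)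
  case (Suc n)
  have "fps_nth ((1 - fps_exp (- 1 :: complex)) ^ Suc n) k =
     (\<Sum>i=0..k. fps_nth ((1 - fps_exp (- 1 :: complex)) ^ n) i * fps_nth (1 - fps_exp (- 1)) (k - i))"
    unfolding power_Suc2 fps_mult_nth ..
  also have "\<dots> = (\<Sum>i=0..k. if i = n \<and> k = Suc n then 1 else 0)"
    using Suc by (intro sum.cong) (auto simp: less_Suc_eq_le le_Suc_eq)
  also have "\<dots> = (if k = Suc n then 1 else 0)"
    by auto
  finally show ?case .
qed auto

text \<open>Leads from formal series back to the finitely supported sequences that items (3) and (4)
  ask for. The induction repairs one coefficient at a time.\<close>

lemma ex_seq_fps_eq_upto: "\<exists>w. fin_supp w \<and> fps_eq_upto m (seq_fps w) f"
proof (induction m)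
  case 0
  show ?case using seq_fps_delta[of 0 "fps_nth f 0"]
    by (intro exI[of _ "\<lambda>k. if k = 0 then fps_nth f 0 else 0"]) (auto simp: fps_eq_upto_def)
next
  case (Suc m)
  then obtain w where w: "fin_supp w" "fps_eq_upto m (seq_fps w) f" by blast
  \<comment> \<open>The scalar is the error of \<open>w\<close> in coefficient \<open>Suc m\<close>;
    the power of order \<open>Suc m\<close> leaves all lower coefficients alone.\<close>
  obtain w' where w': "fin_supp w'"
    "seq_fps w' = fps_const (fps_nth f (Suc m) - fps_nth (seq_fps w) (Suc m)) * (1 - fps_exp (- 1)) ^ Suc m"
    using ex_seq_fps_diff_power by blast
  have "fps_eq_upto (Suc m) (seq_fps (\<lambda>k. w k + w' k)) f"
    using w(2) unfolding fps_eq_upto_def fin_supp_add(2)[OF w(1) w'(1)] w'(2)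
    by (auto simp: fps_nth_one_minus_exp_power le_Suc_eq simp del: power_Suc)
  then show ?case using fin_supp_add(1)[OF w(1) w'(1)] by blast
qed

section \<open>Subdivision of polynomial sequences\<close>

abbreviation vfps :: "(int \<Rightarrow> complex^'r) \<Rightarrow> 'r \<Rightarrow> complex fps" where
  "vfps v i \<equiv> seq_fps (\<lambda>k. v k $ i)"

abbreviation mfps :: "(int \<Rightarrow> complex^'r^'s) \<Rightarrow> 's \<Rightarrow> 'r \<Rightarrow> complex fps" where
  "mfps a i j \<equiv> seq_fps (\<lambda>k. a k $ i $ j)"

text \<open>By Taylor's formula each exponential in the series acts as a shift, so the series acts
  by convolution.\<close>

lemma act_seq_fps:
  assumes "finite K" "\<And>k. k \<notin> K \<Longrightarrow> w k = 0"
  shows "act (seq_fps w) q = (\<Sum>k\<in>K. smult (w k) (q \<circ>\<^sub>p [:- of_int k, 1:]))"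
  by (simp add: seq_fps_eq_sum[of K, OF assms] act_sum_left act_fps_const_mult act_fps_exp)

lemma pconv_nth:
  fixes v :: "int \<Rightarrow> complex^'r"
  assumes "fin_supp v"
  shows "pconv q v $ i = act (vfps v i) q"
proof -
  have fin: "finite {k. v k \<noteq> 0}" using assms by (simp add: fin_supp_def)
  have "pconv q v = (\<Sum>k\<in>{k. v k \<noteq> 0}. \<chi> i. smult (v k $ i) (q \<circ>\<^sub>p [:- of_int k, 1:]))"
    unfolding pconv_def by (rule Sum_any.expand_superset[OF fin]) (auto simp: vec_eq_iff)
  then show ?thesis
    by (subst act_seq_fps[OF fin]) (auto simp: sum_component)
qed

lemma vpconv_nth:
  fixes a :: "int \<Rightarrow> complex^'r^'r"
  assumes "fin_supp a"
  shows "vpconv p a $ j = (\<Sum>i\<in>UNIV. act (mfps a i j) (p $ i))"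
proof -
  have fin: "finite {k. a k \<noteq> 0}" using assms by (simp add: fin_supp_def)
  have "vpconv p a = (\<Sum>k\<in>{k. a k \<noteq> 0}. \<chi> j. \<Sum>i\<in>UNIV. smult (a k $ i $ j) (p $ i \<circ>\<^sub>p [:- of_int k, 1:]))"
    unfolding vpconv_def
    by (rule Sum_any.expand_superset[OF fin], rule subsetI, rule ccontr) (simp add: vec_eq_iff)
  then have "vpconv p a $ j = (\<Sum>i\<in>UNIV. \<Sum>k\<in>{k. a k \<noteq> 0}. smult (a k $ i $ j) (p $ i \<circ>\<^sub>p [:- of_int k, 1:]))"
    by (simp add: sum_component sum.swap[of _ "{k. a k \<noteq> 0}"])
  also have "\<dots> = (\<Sum>i\<in>UNIV. act (mfps a i j) (p $ i))"
    by (intro sum.cong refl act_seq_fps[symmetric] fin) auto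
  finally show ?thesis .
qed

lemma vp_eval_vpconv:
  fixes a :: "int \<Rightarrow> complex^'r^'r"
  assumes "finite K" "\<And>k. k \<notin> K \<Longrightarrow> a k = 0"
  shows "vp_eval (vpconv p a) x = (\<Sum>k\<in>K. vp_eval p (x - of_int k) v* a k)"
proof -
  have fin: "fin_supp a"
    unfolding fin_supp_def by (rule finite_subset[OF _ assms(1)]) (use assms(2) in auto)
  have "vp_eval (vpconv p a) x $ j = (\<Sum>k\<in>K. vp_eval p (x - of_int k) v* a k) $ j" for j
  proof -
    have "vp_eval (vpconv p a) x $ j =
        (\<Sum>i\<in>UNIV. poly (\<Sum>k\<in>K. smult (a k $ i $ j) (p $ i \<circ>\<^sub>p [:- of_int k, 1:])) x)"
      using assms by (simp add: vp_eval_def vpconv_nth[OF fin] poly_sum act_seq_fps[of K])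
    also have "\<dots> = (\<Sum>k\<in>K. \<Sum>i\<in>UNIV. a k $ i $ j * poly (p $ i) (x - of_int k))"
      by (simp add: poly_sum poly_pcompose sum.swap[of _ K])
    finally show ?thesis
      by (simp add: sum_component vector_matrix_mult_def vp_eval_def mult.commute)
  qed
  then show ?thesis by (simp add: vec_eq_iff)
qed

section \<open>Subdivision of a polynomial sequence, split by parity\<close>

lemma vector_matrix_mult_minus: "x v* (- A) = - (x v* (A :: complex^'r^'s))"
  by (simp add: vector_matrix_mult_def vec_eq_iff sum_negf)

text \<open>Put l = j - 2k. The sum then runs over the l of the same parity as j, and twice the
  indicator of that condition is 1 + (-1)^j (-1)^l. The two summands give the convolutions with
  \<open>a\<close> and \<open>alt a\<close>.\<close>

lemma subdiv_vp_seq: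
  fixes a :: "int \<Rightarrow> complex^'r^'r"
  assumes "fin_supp a"
  shows "subdiv a (vp_seq p) j = vp_seq (vpconv (vp_half p) a) j +
    (if even j then 1 else - 1) *s vp_seq (vpconv (vp_half p) (alt a)) j"
proof -
  define L where "L = {k. a k \<noteq> 0}"
  have fin: "finite L" using assms by (simp add: fin_supp_def L_def)
  \<comment> \<open>At l = j - 2k the halved polynomial is evaluated at 2k, so \<open>X l\<close> is
    the \<open>k\<close>-th term of the subdivision sum.\<close>
  define X where "X l = vp_eval (vp_half p) (of_int j - of_int l) v* a l" for l
  have X0: "X l = 0" if "l \<notin> L" for l
    using that by (simp add: X_def L_def)
  have half: "vp_eval (vp_half p) (2 * of_int k) = vp_seq p k" for k
    by (simp add: vp_eval_def vp_half_def vp_seq_def poly_pcompose)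
  have inj: "inj_on (\<lambda>k::int. j - 2 * k) A" for A by (auto simp: inj_on_def)
  define M where "M = {k. j - 2 * k \<in> L}"
  have "M = (\<lambda>k. j - 2 * k) -` L" by (auto simp: M_def)
  then have finM: "finite M" using finite_vimageI[OF fin inj] by simp
  have "Sum_any (\<lambda>k. vp_seq p k v* a (j - 2 * k)) = (\<Sum>k\<in>M. vp_seq p k v* a (j - 2 * k))"
    by (rule Sum_any.expand_superset[OF finM]) (auto simp: M_def L_def)
  also have "\<dots> = (\<Sum>k\<in>M. X (j - 2 * k))"
    by (intro sum.cong refl) (simp add: X_def half)
  also have "\<dots> = (\<Sum>l\<in>(\<lambda>k. j - 2 * k) ` M. X l)"
    by (simp add: sum.reindex[OF inj])
  also have "(\<lambda>k. j - 2 * k) ` M = {l\<in>L. even (j - l)}"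
  proof (intro subset_antisym subsetI)
    fix l assume "l \<in> {l \<in> L. even (j - l)}"
    then obtain k where "j - l = 2 * k" "l \<in> L" by (auto elim!: evenE simp del: even_diff)
    then have "l = j - 2 * k" "l \<in> L" by auto
    then show "l \<in> (\<lambda>k. j - 2 * k) ` M"
      by (intro image_eqI[of _ _ k]) (auto simp: M_def)
  qed (auto simp: M_def)
  finally have lhs: "subdiv a (vp_seq p) j = 2 *s (\<Sum>l\<in>{l\<in>L. even (j - l)}. X l)"
    by (simp add: subdiv_def)
  have plus: "vp_seq (vpconv (vp_half p) a) j = (\<Sum>l\<in>L. X l)"
    unfolding vp_seq_def X_def by (rule vp_eval_vpconv[OF fin]) (simp add: L_def)
  have "vp_seq (vpconv (vp_half p) (alt a)) j =
      (\<Sum>l\<in>L. vp_eval (vp_half p) (of_int j - of_int l) v* alt a l)"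
    unfolding vp_seq_def by (rule vp_eval_vpconv[OF fin]) (simp add: L_def alt_def)
  also have "\<dots> = (\<Sum>l\<in>L. if even l then X l else - X l)"
    by (intro sum.cong refl) (auto simp: alt_def X_def vector_matrix_mult_minus)
  finally have minus: "(if even j then 1 else - 1) *s vp_seq (vpconv (vp_half p) (alt a)) j =
      (\<Sum>l\<in>L. if even (j - l) then X l else - X l)"
    by (auto simp: vec_eq_iff sum_component simp flip: sum_negf intro!: sum.cong)
  have "(\<Sum>l\<in>{l\<in>L. even (j - l)}. X l) = (\<Sum>l\<in>L. if even (j - l) then X l else 0)"
    using fin by (simp add: sum.inter_filter)
  then show ?thesis
    unfolding lhs plus minus sum.distrib[symmetric]
    by (auto simp: vec_eq_iff sum_component sum_distrib_left intro!: sum.cong)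
qed

text \<open>A nonzero polynomial has finitely many roots. The offset \<open>e\<close> serves to
  select the even or the odd integers.\<close>

lemma poly_eq_on_progression:
  fixes p q :: "complex poly"
  assumes "\<And>k::int. poly p (of_int (2 * k + e)) = poly q (of_int (2 * k + e))"
  shows "p = q"
proof (rule ccontr)
  assume "p \<noteq> q"
  then have "finite {x. poly (p - q) x = 0}" by (intro poly_roots_finite) simp
  moreover have "range (\<lambda>k::int. of_int (2 * k + e)) \<subseteq> {x. poly (p - q) x = 0}"
    using assms by auto
  moreover have "infinite (range (\<lambda>k::int. of_int (2 * k + e) :: complex))"
    using finite_imageD[of "\<lambda>k::int. of_int (2 * k + e) :: complex" UNIV] infinite_UNIV_int
    by (auto simp: inj_on_def)
  ultimately show False using finite_subset by blast
qed

lemma vp_eq_on_progression: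
  assumes "\<And>k::int. vp_seq p (2 * k + e) = vp_seq q (2 * k + e)"
  shows "p = q"
  using assms unfolding vp_seq_def vp_eval_def vec_eq_iff
  by (auto intro!: poly_eq_on_progression[of _ e])

lemma vp_seq_inject [simp]: "vp_seq p = vp_seq q \<longleftrightarrow> p = q"
  using vp_eq_on_progression[of p 0 q] by auto

lemma vp_seq_add: "vp_seq (p + q) k = vp_seq p k + vp_seq q k"
  by (simp add: vp_seq_def vp_eval_def vec_eq_iff)

lemma vp_seq_diff: "vp_seq (p - q) k = vp_seq p k - vp_seq q k"
  by (simp add: vp_seq_def vp_eval_def vec_eq_iff)

text \<open>With A and B the convolutions with \<open>a\<close> and \<open>alt a\<close>, the even
  integers yield A + B = q and the odd ones A - B = q, both as identities of polynomials. Hence B =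
  0.\<close>

lemma subdiv_eq_vp_seq_iff:
  fixes a :: "int \<Rightarrow> complex^'r^'r"
  assumes "fin_supp a"
  shows "subdiv a (vp_seq p) = vp_seq q \<longleftrightarrow>
    vpconv (vp_half p) a = q \<and> vpconv (vp_half p) (alt a) = 0"
proof
  let ?A = "vpconv (vp_half p) a" and ?B = "vpconv (vp_half p) (alt a)"
  assume eq: "subdiv a (vp_seq p) = vp_seq q"
  have "vp_seq (?A + ?B) (2 * k + 0) = vp_seq q (2 * k + 0)" for k
    using fun_cong[OF eq, of "2 * k"] by (simp add: subdiv_vp_seq[OF assms] vp_seq_add)
  then have 1: "?A + ?B = q" by (rule vp_eq_on_progression)
  have "vp_seq (?A - ?B) (2 * k + 1) = vp_seq q (2 * k + 1)" for k
    using fun_cong[OF eq, of "2 * k + 1"] by (simp add: subdiv_vp_seq[OF assms] vp_seq_diff)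
  then have 2: "?A - ?B = q" by (rule vp_eq_on_progression)
  have "poly (?B $ i) x = 0" for i x
    using arg_cong[OF trans[OF 1 2[symmetric]], of "\<lambda>p. poly (p $ i) x"] by simp
  then have "?B = 0" by (simp add: vec_eq_iff poly_all_0_iff_0[symmetric])
  with 1 show "?A = q \<and> ?B = 0" by simp
next
  have 0: "vp_seq 0 k = 0" for k :: int
    by (simp add: vp_seq_def vp_eval_def vec_eq_iff)
  assume "vpconv (vp_half p) a = q \<and> vpconv (vp_half p) (alt a) = 0"
  then show "subdiv a (vp_seq p) = vp_seq q"
    by (auto simp: fun_eq_iff subdiv_vp_seq[OF assms] 0)
qed

text \<open>The series of the product of the symbols of \<open>v\<close> at \<open>2\<xi>\<close> and of \<open>a\<close> at \<open>\<xi>\<close>.\<close>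

definition tsym :: "(int \<Rightarrow> complex^'r) \<Rightarrow> (int \<Rightarrow> complex^'r^'r) \<Rightarrow> 'r \<Rightarrow> complex fps" where
  "tsym v a j = (\<Sum>i\<in>UNIV. dil (vfps v i) * mfps a i j)"

text \<open>Halving dilates the series of \<open>v\<close> by \<open>half_act\<close>, and
  successive actions compose to the action of the product.\<close>

lemma vpconv_half_pconv:
  fixes a :: "int \<Rightarrow> complex^'r^'r"
  assumes "fin_supp a" "fin_supp v"
  shows "vpconv (vp_half (pconv q v)) a $ j = act (tsym v a j) (half q)"
  using assms
  by (simp add: vpconv_nth vp_half_def pconv_nth half_act tsym_def act_sum_left mult.commute
      flip: act_mult)

lemma subdiv_pconv_iff:
  fixes a :: "int \<Rightarrow> complex^'r^'r"
  assumes "fin_supp a" "fin_supp v"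
  shows "subdiv a (vp_seq (pconv q v)) = vp_seq s \<longleftrightarrow>
    (\<forall>j. act (tsym v a j) (half q) = s $ j \<and> act (tsym v (alt a) j) (half q) = 0)"
  using assms
  by (auto simp: subdiv_eq_vp_seq_iff vec_eq_iff vpconv_half_pconv fin_supp_alt)

text \<open>The two congruences in item (3), for the series \<open>c\<close> of the symbol called \<open>c\<close> there.\<close>

definition sr_cond :: "nat \<Rightarrow> (int \<Rightarrow> complex^'r^'r) \<Rightarrow> (int \<Rightarrow> complex^'r) \<Rightarrow> complex fps \<Rightarrow> bool" where
  "sr_cond m a v c \<longleftrightarrow>
     (\<forall>j. fps_eq_upto m (tsym v a j) (c * vfps v j) \<and> fps_eq_upto m (tsym v (alt a) j) 0)"

text \<open>Congruent series act alike on degrees up to \<open>m\<close>. So on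
  \<open>Pspace m v\<close> subdivision corresponds to the scalar operator taking \<open>q\<close>
  to \<open>act c (half q)\<close>, and everything below is read off from that operator.\<close>

lemma sr_cond_subdiv:
  fixes a :: "int \<Rightarrow> complex^'r^'r"
  assumes "fin_supp a" "fin_supp v" "sr_cond m a v c" "degree q \<le> m"
  shows "subdiv a (vp_seq (pconv q v)) = vp_seq (pconv (act c (half q)) v)"
proof -
  have hq: "degree (half q) \<le> m" using assms by simp
  have "act (tsym v a j) (half q) = act (c * vfps v j) (half q)"
       "act (tsym v (alt a) j) (half q) = act 0 (half q)" for j
    using assms(3) hq unfolding sr_cond_def by (blast intro: act_cong)+
  then show ?thesis
    unfolding subdiv_pconv_iff[OF assms(1,2)]
    by (simp add: pconv_nth assms(2) mult.commute flip: act_mult)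
qed

text \<open>One polynomial of degree exactly \<open>m\<close> suffices: \<open>half q\<close> is
  cyclic, which provides \<open>c\<close>, and its annihilator turns equality of actions into
  congruence of series.\<close>

lemma subdiv_imp_sr_cond:
  fixes a :: "int \<Rightarrow> complex^'r^'r"
  assumes "fin_supp a" "fin_supp v" "degree q = m" "q \<noteq> 0" "degree q1 \<le> m"
    and eq: "subdiv a (vp_seq (pconv q v)) = vp_seq (pconv q1 v)"
  obtains c where "sr_cond m a v c" "q1 = act c (half q)"
proof -
  have hq: "degree (half q) = m" "half q \<noteq> 0" using assms by simp_all
  obtain c where c: "q1 = act c (half q)"
    using act_surj[OF hq assms(5)] .
  have "act (tsym v a j) (half q) = act (c * vfps v j) (half q) \<and>
      act (tsym v (alt a) j) (half q) = act 0 (half q)" for j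
    using eq unfolding subdiv_pconv_iff[OF assms(1,2)] c
    by (simp add: pconv_nth assms(2) mult.commute flip: act_mult)
  then have "sr_cond m a v c"
    unfolding sr_cond_def act_eq_iff[OF hq] by blast
  then show ?thesis using c that by blast
qed

section \<open>Sum rules and invariant polynomial spaces\<close>

lemma vp_seq_scale: "vp_seq (vp_scale c p) = (\<lambda>k. c *s vp_seq p k)"
  by (simp add: fun_eq_iff vp_seq_def vp_eval_def vp_scale_def vec_eq_iff)

lemma vp_seq_0: "vp_seq 0 = (\<lambda>_. 0)"
  by (simp add: fun_eq_iff vp_seq_def vp_eval_def vec_eq_iff)

lemma vp_deriv_funpow_nth: "(vp_deriv ^^ n) p $ i = (pderiv ^^ n) (p $ i)"
  by (induction n) (simp_all add: vp_deriv_def)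

lemma pconv_smult: "fin_supp v \<Longrightarrow> pconv (smult c q) v = vp_scale c (pconv q v)"
  by (simp add: vec_eq_iff pconv_nth vp_scale_def act_smult_right)

lemma pconv_add: "fin_supp v \<Longrightarrow> pconv (p + q) v = pconv p v + pconv q v"
  by (simp add: vec_eq_iff pconv_nth act_add_right)

lemma pconv_0: "fin_supp v \<Longrightarrow> pconv 0 v = 0"
  by (simp add: vec_eq_iff pconv_nth)

lemma pconv_sum: "fin_supp v \<Longrightarrow> pconv (\<Sum>i\<in>A. q i) v = (\<Sum>i\<in>A. pconv (q i) v)"
  by (simp add: vec_eq_iff pconv_nth act_sum_right sum_component)

lemma pconv_deriv: "fin_supp v \<Longrightarrow> (vp_deriv ^^ n) (pconv q v) = pconv ((pderiv ^^ n) q) v"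
  by (simp add: vec_eq_iff pconv_nth act_higher_pderiv vp_deriv_funpow_nth)

lemma vfps_nth_0: "fin_supp v \<Longrightarrow> fps_nth (vfps v i) 0 = vsymbol v 0 $ i"
  by (simp add: vsymbol_def seq_fps_nth_0 fin_supp_nth)

lemma pconv_1: "fin_supp v \<Longrightarrow> vp_seq (pconv 1 v) = (\<lambda>_. vsymbol v 0)"
  by (simp add: fun_eq_iff vec_eq_iff vp_seq_def vp_eval_def pconv_nth act_def vfps_nth_0)

text \<open>The top coefficient is multiplied by the \<open>i\<close>-th entry of the symbol at
  \<open>0\<close>, so it survives where that entry is nonzero.\<close>

lemma degree_pconv_nth:
  assumes "fin_supp v" "vsymbol v 0 $ i \<noteq> 0"
  shows "degree (pconv q v $ i) = degree q" "pconv q v $ i = 0 \<longleftrightarrow> q = 0"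
proof -
  have *: "coeff (pconv q v $ i) (degree q) = vsymbol v 0 $ i * lead_coeff q"
    by (simp add: pconv_nth[OF assms(1)] coeff_degree_act vfps_nth_0[OF assms(1)])
  show "pconv q v $ i = 0 \<longleftrightarrow> q = 0"
    using * assms by (auto simp: pconv_0)
  show "degree (pconv q v $ i) = degree q"
  proof (cases "q = 0")
    case False
    then have "degree q \<le> degree (pconv q v $ i)"
      using * assms by (intro le_degree) simp
    moreover have "degree (pconv q v $ i) \<le> degree q"
      by (simp add: pconv_nth[OF assms(1)] degree_act_le)
    ultimately show ?thesis by simp
  qed (simp add: pconv_0 assms)
qed

lemma pconv_inject:
  assumes "fin_supp v" "vsymbol v 0 \<noteq> 0"
  shows "pconv p v = pconv q v \<longleftrightarrow> p = q"
proof
  obtain i where i: "vsymbol v 0 $ i \<noteq> 0" using assms(2) by (auto simp: vec_eq_iff)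
  assume "pconv p v = pconv q v"
  then have "pconv (p + smult (- 1) q) v $ i = 0"
    by (simp only: pconv_add[OF assms(1)] pconv_smult[OF assms(1)]) (simp add: vp_scale_def)
  then show "p = q" using degree_pconv_nth(2)[OF assms(1) i] by simp
qed simp

lemma pconv_eq_0_iff:
  assumes "fin_supp v" "vsymbol v 0 \<noteq> 0"
  shows "pconv q v = 0 \<longleftrightarrow> q = 0"
  using pconv_inject[OF assms, of q 0] by (simp add: pconv_0 assms(1))

lemma vp_has_degree_pconv:
  assumes "fin_supp v" "vsymbol v 0 \<noteq> 0"
  shows "vp_has_degree (pconv q v) n \<longleftrightarrow> q \<noteq> 0 \<and> degree q = n"
proof -
  obtain i where i: "vsymbol v 0 $ i \<noteq> 0" using assms(2) by (auto simp: vec_eq_iff)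
  have "Max (range (\<lambda>i. degree (pconv q v $ i))) = degree q"
  proof (rule Max_eqI)
    show "degree q \<in> range (\<lambda>i. degree (pconv q v $ i))"
      using degree_pconv_nth(1)[OF assms(1) i, of q] by (metis rangeI)
  qed (auto simp: pconv_nth[OF assms(1)] degree_act_le)
  then show ?thesis by (simp add: vp_has_degree_def pconv_eq_0_iff[OF assms])
qed

text \<open>Differentiation commutes with convolution and lowers the index of \<open>epoly\<close>,
  so the generators are the convolutions of the \<open>epoly n\<close> with
  \<open>n \<le> m\<close>.\<close>

lemma span_derivs_eq_Pspace:
  assumes "fin_supp v"
  shows "module.span vp_scale {(vp_deriv ^^ j) (pconv (epoly m) v) | j. j \<le> m} = Pspace m v"
proof -
  interpret vector_space "vp_scale :: complex \<Rightarrow> 'a::finite vpoly \<Rightarrow> 'a vpoly"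
    by (rule vector_space_vp_scale)
  let ?B = "{(vp_deriv ^^ j) (pconv (epoly m) v) | j. j \<le> m}"
  have B: "?B = {pconv (epoly (m - j)) v | j. j \<le> m}"
  proof -
    have "(vp_deriv ^^ j) (pconv (epoly m) v) = pconv (epoly (m - j)) v" if "j \<le> m" for j
      using that by (simp add: pconv_deriv assms higher_pderiv_epoly)
    then show ?thesis by (intro Collect_cong ex_cong1) auto
  qed
  show ?thesis
  proof
    show "span ?B \<subseteq> Pspace m v"
    proof (rule span_minimal)
      show "?B \<subseteq> Pspace m v" unfolding B by (auto simp: Pspace_def)
      show "subspace (Pspace m v)"
      proof (rule subspaceI)
        show "0 \<in> Pspace m v"
          using pconv_0[OF assms] by (auto simp: Pspace_def intro!: exI[of _ 0])
      next
        fix x y assume "x \<in> Pspace m v" "y \<in> Pspace m v"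
        then show "x + y \<in> Pspace m v"
          by (auto simp: Pspace_def simp flip: pconv_add[OF assms] intro: degree_add_le)
      next
        fix c x assume "x \<in> Pspace m v"
        then show "vp_scale c x \<in> Pspace m v"
          by (auto simp: Pspace_def simp flip: pconv_smult[OF assms]
              intro: order.trans[OF degree_smult_le])
      qed
    qed
    show "Pspace m v \<subseteq> span ?B"
    proof
      fix x assume "x \<in> Pspace m v"
      then obtain q where q: "x = pconv q v" "degree q \<le> m" by (auto simp: Pspace_def)
      obtain f where "q = act f (epoly m)" using act_epoly_surj[OF q(2)] by metis
      then have "x = (\<Sum>n\<le>m. vp_scale (fps_nth f n) (pconv (epoly (m - n)) v))"
        by (simp add: q act_epoly pconv_sum pconv_smult assms)
      also have "\<dots> \<in> span ?B"
        unfolding B by (intro span_sum span_scale span_base) auto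
      finally show "x \<in> span ?B" .
    qed
  qed
qed

section \<open>Congruences of series and the conditions on symbols near \<open>0\<close>\<close>

lemma expands_product:
  fixes a :: "int \<Rightarrow> complex^'r^'r"
  assumes "fin_supp a" "fin_supp v"
  shows "expands (\<lambda>\<xi>. (vsymbol v (2 * \<xi>) v* msymbol a \<xi>) $ j) (tsym v a j)"
proof -
  have "expands (\<lambda>\<xi>. \<Sum>i\<in>UNIV. symbol (\<lambda>k. v k $ i) (2 * \<xi>) * symbol (\<lambda>k. a k $ i $ j) \<xi>) (tsym v a j)"
    unfolding tsym_def
    by (intro expands_sum expands_mult expands_double expands_symbol fin_supp_nth assms)
  then show ?thesis
    by (simp add: vector_matrix_mult_def vsymbol_def msymbol_def mult.commute)
qed

text \<open>Stated for any \<open>c\<close> with an expansion, to cover both the symbol in item (3)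
  and the constant \<open>1\<close> in the sum rules.\<close>

lemma sr_cond_iff_eq_upto_O:
  fixes a :: "int \<Rightarrow> complex^'r^'r"
  assumes "fin_supp a" "fin_supp v" "expands c C"
  shows "sr_cond m a v C \<longleftrightarrow>
    eq_upto_O (m + 1) (\<lambda>\<xi>. vsymbol v (2 * \<xi>) v* msymbol a \<xi>) (\<lambda>\<xi>. c \<xi> *s vsymbol v \<xi>) \<and>
    eq_upto_O (m + 1) (\<lambda>\<xi>. vsymbol v (2 * \<xi>) v* msymbol a (\<xi> + pi)) (\<lambda>\<xi>. 0)"
proof -
  have v: "expands (\<lambda>\<xi>. (c \<xi> *s vsymbol v \<xi>) $ j) (C * vfps v j)" for j
    unfolding vector_smult_component vsymbol_def vec_lambda_beta
    by (intro expands_mult expands_symbol fin_supp_nth assms)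
  have 0: "expands (\<lambda>\<xi>. (0 :: complex^'r) $ j) 0" for j
    by (simp add: expands_0)
  show ?thesis
    unfolding sr_cond_def msymbol_shift
      eq_upto_O_expands[OF expands_product[OF assms(1,2)] v]
      eq_upto_O_expands[OF expands_product[OF fin_supp_alt[OF assms(1)] assms(2)] 0]
    by blast
qed

lemma expands_1: "expands (\<lambda>_. 1) 1"
  unfolding expands_def by (rule exI[of _ "\<lambda>_. 1"]) auto

lemma sum_rules_iff:
  fixes a :: "int \<Rightarrow> complex^'r^'r"
  assumes "fin_supp a" "fin_supp u"
  shows "sum_rules (m + 1) a u \<longleftrightarrow> sr_cond m a u 1"
  unfolding sum_rules_def sr_cond_iff_eq_upto_O[OF assms expands_1] by simp

section \<open>Changing the vector sequence by a scalar factor\<close>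

lemma dil_mult: "dil (f * g) = dil f * dil g"
  by (rule fps_compose_mult_distrib) simp

lemma tsym_mult:
  assumes "\<And>i. vfps u i = d * vfps v i"
  shows "tsym u a j = dil d * tsym v a j"
  by (simp add: tsym_def assms dil_mult sum_distrib_left mult.assoc)

text \<open>Passing from \<open>v\<close> to \<open>u\<close> multiplies the left sides by d(2X) and
  \<open>vfps v\<close> by d(X). The unit d(2X) cancels once d(2X) c = b d.\<close>

lemma sr_cond_mult_iff:
  assumes "\<And>i. vfps u i = d * vfps v i" "fps_nth d 0 \<noteq> 0" "fps_eq_upto m (dil d * c) (b * d)"
  shows "sr_cond m a u b \<longleftrightarrow> sr_cond m a v c"
proof -
  have d: "fps_nth (dil d) 0 \<noteq> 0" using assms by simp
  have 1: "fps_eq_upto m (dil d * c * V) (b * d * V)" for V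
    using assms(3) by (rule fps_eq_upto_mult) (rule fps_eq_upto_refl)
  have "fps_eq_upto m (dil d * W) (b * d * V) \<longleftrightarrow> fps_eq_upto m W (c * V)" for W V
  proof -
    have "fps_eq_upto m (dil d * W) (b * d * V) \<longleftrightarrow> fps_eq_upto m (dil d * W) (dil d * (c * V))"
      using 1[of V] unfolding fps_eq_upto_def mult.assoc by simp
    then show ?thesis unfolding fps_eq_upto_mult_unit_iff[OF d] .
  qed
  moreover have "fps_eq_upto m (dil d * W) 0 \<longleftrightarrow> fps_eq_upto m W 0" for W
    using fps_eq_upto_mult_unit_iff[OF d, of m W 0] by simp
  ultimately show ?thesis
    unfolding sr_cond_def tsym_mult[OF assms(1)] assms(1) by (simp add: mult.assoc)
qed

text \<open>Sum rules for \<open>u\<close> are the case \<open>b = 1\<close> of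
  \<open>sr_cond_mult_iff\<close>, for which c = d(X) / d(2X).\<close>

lemma sum_rule_vectorD:
  fixes a :: "int \<Rightarrow> complex^'r^'r"
  assumes "fin_supp a" "fin_supp v" "sum_rule_vector m a v u"
  obtains d where "fin_supp u" "fps_nth d 0 = 1" "\<And>i. vfps u i = d * vfps v i"
    "sr_cond m a u 1" "sr_cond m a v (d * inverse (dil d))"
proof -
  obtain d where d: "fin_supp d" "symbol d 0 = 1" "fin_supp u"
    "\<And>\<xi>. vsymbol u \<xi> = symbol d \<xi> *s vsymbol v \<xi>" "sum_rules (m + 1) a u"
    using assms(3) by (auto simp: sum_rule_vector_def)
  have U: "vfps u i = seq_fps d * vfps v i" for i
  proof (rule expands_unique)
    show "expands (symbol (\<lambda>k. u k $ i)) (vfps u i)"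
      by (intro expands_symbol fin_supp_nth d)
    have "symbol (\<lambda>k. u k $ i) = (\<lambda>\<xi>. symbol d \<xi> * symbol (\<lambda>k. v k $ i) \<xi>)"
      using d(4) by (simp add: vsymbol_def vec_eq_iff fun_eq_iff)
    then show "expands (symbol (\<lambda>k. u k $ i)) (seq_fps d * vfps v i)"
      by (simp add: expands_mult expands_symbol fin_supp_nth d assms)
  qed
  have d0: "fps_nth (seq_fps d) 0 = 1" using d by (simp add: seq_fps_nth_0)
  have 1: "sr_cond m a u 1" using d sum_rules_iff assms(1) by blast
  have "dil (seq_fps d) * (seq_fps d * inverse (dil (seq_fps d))) = 1 * seq_fps d"
    using inverse_mult_eq_1'[of "dil (seq_fps d)"] d0 by (simp add: mult.left_commute)
  then have "sr_cond m a v (seq_fps d * inverse (dil (seq_fps d)))"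
    using sr_cond_mult_iff[of u "seq_fps d" v m _ 1 a, OF U] d0 1 by (metis fps_eq_upto_refl zero_neq_one)
  then show ?thesis using that[OF d(3) d0 U 1] by blast
qed

text \<open>The coefficients of the solution \<open>d\<close> of \<open>d(2X) c(X) = d(X)\<close> with \<open>d(0) = 1\<close>.\<close>

fun dil_coeff :: "complex fps \<Rightarrow> nat \<Rightarrow> complex" where
  "dil_coeff c n = (if n = 0 then 1 else
     (\<Sum>k<n. 2 ^ k * dil_coeff c k * fps_nth c (n - k)) / (1 - 2 ^ n))"

declare dil_coeff.simps [simp del]

text \<open>Comparing coefficients at X^n determines (1 - 2^n) d_n from lower ones, and 1 - 2^n
  vanishes only for n = 0. There the equation holds because \<open>c\<close> has constant term
  \<open>1\<close>.\<close>

lemma ex_dil_mult_eq: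
  assumes "fps_nth c 0 = 1"
  obtains d where "fps_nth d 0 = 1" "dil d * c = d"
proof
  let ?d = "Abs_fps (dil_coeff c)"
  show "fps_nth ?d 0 = 1" by (simp add: dil_coeff.simps)
  show "dil ?d * c = ?d"
  proof (rule fps_ext)
    fix n
    have "fps_nth (dil ?d * c) n = (\<Sum>k<n. 2 ^ k * dil_coeff c k * fps_nth c (n - k)) + 2 ^ n * dil_coeff c n"
      using assms by (simp add: fps_mult_nth atLeast0AtMost lessThan_Suc_atMost[symmetric])
    also have "\<dots> = dil_coeff c n"
    proof (cases "n = 0")
      case False
      have "(2::complex) ^ n \<noteq> 1"
      proof
        assume "(2::complex) ^ n = 1"
        then have "norm ((2::complex) ^ n) = 1" by simp
        then have "(2::real) ^ n = 1" by (simp add: norm_power)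
        then show False using False one_less_power[of "2::real" n] by simp
      qed
      then have "(1 - 2 ^ n) * dil_coeff c n = (\<Sum>k<n. 2 ^ k * dil_coeff c k * fps_nth c (n - k))"
        by (subst dil_coeff.simps) (simp add: False)
      then show ?thesis by (simp add: algebra_simps)
    qed (simp add: dil_coeff.simps)
    finally show "fps_nth (dil ?d * c) n = fps_nth ?d n" by simp
  qed
qed

text \<open>Solve for a formal \<open>d\<close>, replace it by the series of a finitely supported
  \<open>w\<close>, and convolve \<open>w\<close> with \<open>v\<close>. The conditions see only
  coefficients up to \<open>m\<close>, so the replacement is harmless.\<close>

lemma ex_sum_rule_vector:
  fixes a :: "int \<Rightarrow> complex^'r^'r"
  assumes "fin_supp a" "fin_supp v" "fps_nth c 0 = 1" "sr_cond m a v c"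
  shows "\<exists>u. sum_rule_vector m a v u"
proof -
  obtain d where d: "fps_nth d 0 = 1" "dil d * c = d" using ex_dil_mult_eq assms(3) .
  obtain w where w: "fin_supp w" "fps_eq_upto m (seq_fps w) d" using ex_seq_fps_eq_upto by blast
  have w0: "fps_nth (seq_fps w) 0 = 1" using w(2) d(1) by (simp add: fps_eq_upto_def)
  define u where "u k = (\<chi> i. cconv w (\<lambda>k. v k $ i) k)" for k
  have "finite (\<Union>i. {k. cconv w (\<lambda>k. v k $ i) k \<noteq> 0})"
    using symbol_cconv(1)[OF w(1) fin_supp_nth[OF assms(2)]] by (simp add: fin_supp_def)
  then have u: "fin_supp u"
    unfolding fin_supp_def by (rule rev_finite_subset) (auto simp: u_def vec_eq_iff)
  have "fps_eq_upto m (dil (seq_fps w) * c) (dil d * c)"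
    by (intro fps_eq_upto_mult fps_eq_upto_dil w) auto
  also have "fps_eq_upto m (dil d * c) (1 * seq_fps w)"
    using w(2) by (simp add: d(2) fps_eq_upto_sym)
  finally have "sr_cond m a u 1"
    using sr_cond_mult_iff[of u "seq_fps w" v m c 1 a] w0 assms(4)
    by (simp add: u_def seq_fps_cconv[OF w(1) fin_supp_nth[OF assms(2)]])
  moreover have "vsymbol u \<xi> = symbol w \<xi> *s vsymbol v \<xi>" for \<xi>
    using symbol_cconv(2)[OF w(1) fin_supp_nth[OF assms(2)]] by (simp add: vsymbol_def u_def vec_eq_iff)
  moreover have "symbol w 0 = 1" using w0 seq_fps_nth_0[OF w(1)] by simp
  ultimately show ?thesis
    unfolding sum_rule_vector_def using w(1) u sum_rules_iff[OF assms(1) u] by blast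
qed

section \<open>Explicit expansions in terms of derivatives of symbols\<close>

lemma nth_deriv_vsymbol:
  assumes "fin_supp u"
  shows "nth_deriv k (vsymbol u) 0 $ i = \<i> ^ k * fact k * fps_nth (vfps u i) k"
proof -
  have e: "expands (\<lambda>\<xi>. vsymbol u \<xi> $ i) (vfps u i)" for i
    by (simp add: vsymbol_def expands_symbol fin_supp_nth assms)
  show ?thesis
    using nth_deriv_vec(1)[of "vsymbol u" k 0 i] expands_derivs[OF e] by simp
qed

lemma nth_deriv_msymbol:
  fixes a :: "int \<Rightarrow> complex^'r^'s"
  assumes "fin_supp a"
  shows "nth_deriv k (msymbol a) 0 $ i $ j = \<i> ^ k * fact k * fps_nth (mfps a i j) k"
proof -
  have e: "expands (\<lambda>\<xi>. msymbol a \<xi> $ i $ j) (mfps a i j)" for i j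
    by (simp add: msymbol_def expands_symbol fin_supp_nth assms)
  have 1: "rsmooth (\<lambda>\<xi>. msymbol a \<xi> $ i)" for i
    by (rule nth_deriv_vec(2)) (rule expands_derivs(1)[OF e])
  show ?thesis
    using nth_deriv_vec(1)[of "msymbol a" k 0 i, OF 1]
      nth_deriv_vec(1)[of "\<lambda>\<xi>. msymbol a \<xi> $ i" k 0 j, OF expands_derivs(1)[OF e]]
      expands_derivs(2)[OF e] by simp
qed

text \<open>This is \<open>act_epoly\<close> rewritten: \<open>(- \<i>) ^ k\<close> cancels the
  \<open>\<i> ^ k\<close> from differentiating the symbol.\<close>

lemma vp_eval_pconv_epoly:
  assumes "fin_supp u"
  shows "vp_eval (pconv (epoly j) u) x =
    (\<Sum>k=0..j. ((- \<i>) ^ k / (fact k * fact (j - k)) * x ^ (j - k)) *s nth_deriv k (vsymbol u) 0)"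
proof -
  have i: "(- \<i>) ^ k * \<i> ^ k = 1" for k
    by (simp flip: power_mult_distrib)
  show ?thesis
    unfolding vec_eq_iff vp_eval_def vec_lambda_beta pconv_nth[OF assms] act_epoly poly_sum sum_component
      atLeast0AtMost vector_smult_component nth_deriv_vsymbol[OF assms]
  proof (intro allI sum.cong refl)
    fix l k
    have "(- \<i>) ^ k / (fact k * fact (j - k)) * x ^ (j - k) * (\<i> ^ k * fact k * fps_nth (vfps u l) k) =
       ((- \<i>) ^ k * \<i> ^ k) * (fps_nth (vfps u l) k * (x ^ (j - k) / fact (j - k)))"
      by simp
    also have "\<dots> = poly (smult (fps_nth (vfps u l) k) (epoly (j - k))) x"
      unfolding i by (simp add: epoly_def poly_monom)
    finally show "poly (smult (fps_nth (vfps u l) k) (epoly (j - k))) x =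
       (- \<i>) ^ k / (fact k * fact (j - k)) * x ^ (j - k) * (\<i> ^ k * fact k * fps_nth (vfps u l) k)" ..
  qed
qed

text \<open>The factor \<open>2 ^ j\<close> undoes the chain rule for
  \<open>vp_half\<close>.\<close>

lemma vp_scale_deriv_vpconv:
  fixes a :: "int \<Rightarrow> complex^'r^'r"
  assumes "fin_supp a"
  shows "vp_scale (2 ^ j) ((vp_deriv ^^ j) (vpconv (vp_half q) a)) = vpconv (vp_half ((vp_deriv ^^ j) q)) a"
  by (simp add: vec_eq_iff vp_scale_def vp_deriv_funpow_nth vpconv_nth assms higher_pderiv_sum
      smult_sum_right vp_half_def higher_pderiv_half act_smult_right flip: act_higher_pderiv)

text \<open>The action of the series of \<open>a\<close> on the halved polynomial, term by term;
  \<open>2 ^ k\<close> comes from the chain rule.\<close>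

lemma sums_vpconv:
  fixes a :: "int \<Rightarrow> complex^'r^'r"
  assumes "fin_supp a"
  shows "(\<lambda>k. ((- \<i>) ^ k / (fact k * 2 ^ k)) *s
      (vp_eval (vp_half ((vp_deriv ^^ k) q)) x v* nth_deriv k (msymbol a) 0))
    sums vp_eval (vpconv (vp_half q) a) x"
proof -
  \<comment> \<open>The sum of the degrees bounds each of them, and beyond \<open>N\<close> all
    terms of the series are zero.\<close>
  define N where "N = (\<Sum>i\<in>UNIV. degree (q $ i))"
  have N: "degree (q $ i) \<le> N" for i
    unfolding N_def by (rule member_le_sum) auto
  have i: "(- \<i>) ^ k * \<i> ^ k = 1" for k
    by (simp flip: power_mult_distrib)
  let ?t = "\<lambda>k. ((- \<i>) ^ k / (fact k * 2 ^ k)) *s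
      (vp_eval (vp_half ((vp_deriv ^^ k) q)) x v* nth_deriv k (msymbol a) 0)"
  have t: "?t k $ j = (\<Sum>i\<in>UNIV. fps_nth (mfps a i j) k * poly ((pderiv ^^ k) (half (q $ i))) x)" for k j
  proof -
    have "?t k $ j = (\<Sum>i\<in>UNIV. ((- \<i>) ^ k / (fact k * 2 ^ k)) *
       ((\<i> ^ k * fact k * fps_nth (mfps a i j) k) * poly (half ((pderiv ^^ k) (q $ i))) x))"
      by (simp add: vector_matrix_mult_def nth_deriv_msymbol[OF assms] vp_eval_def vp_half_def
          vp_deriv_funpow_nth sum_distrib_left mult_ac)
    also have "\<dots> = (\<Sum>i\<in>UNIV. ((- \<i>) ^ k * \<i> ^ k) *
       (fps_nth (mfps a i j) k * poly (smult (1 / 2 ^ k) (half ((pderiv ^^ k) (q $ i)))) x))"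
      by (intro sum.cong) (simp_all add: mult_ac)
    finally show ?thesis by (simp only: i higher_pderiv_half mult_1_left)
  qed
  have "?t k = 0" if "k \<notin> {..N}" for k
  proof -
    have "(pderiv ^^ k) (half (q $ i)) = 0" for i
      using N[of i] that by (intro higher_pderiv_eq_0) auto
    then show ?thesis by (simp add: vec_eq_iff t del: vector_smult_component)
  qed
  then have "?t sums (\<Sum>k\<le>N. ?t k)"
    by (intro sums_finite) auto
  also have "(\<Sum>k\<le>N. ?t k) = vp_eval (vpconv (vp_half q) a) x"
  proof -
    have "(\<Sum>k\<le>N. ?t k) $ j = vp_eval (vpconv (vp_half q) a) x $ j" for j
    proof -
      have "(\<Sum>k\<le>N. ?t k) $ j = (\<Sum>k\<le>N. ?t k $ j)" by (rule sum_component)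
      also have "\<dots> = (\<Sum>i\<in>UNIV. \<Sum>k\<le>N. fps_nth (mfps a i j) k * poly ((pderiv ^^ k) (half (q $ i))) x)"
        unfolding t by (rule sum.swap)
      also have "\<dots> = (\<Sum>i\<in>UNIV. poly (act (mfps a i j) (half (q $ i))) x)"
        using N by (simp add: act_bound[where N = N] poly_sum)
      finally show ?thesis
        by (simp add: vp_eval_def vpconv_nth[OF assms] vp_half_def poly_sum)
    qed
    then show ?thesis by (simp add: vec_eq_iff)
  qed
  finally show ?thesis .
qed

lemma act_half_1: "act c (half 1) = smult (fps_nth c 0) 1"
  by (simp add: pcompose_1 act_def)

lemma pconv_in_Pspace: "degree q \<le> m \<Longrightarrow> pconv q v \<in> Pspace m v"
  by (auto simp: Pspace_def)

lemma Pspace_deriv: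
  assumes "fin_supp v" "q \<in> Pspace m v"
  shows "(vp_deriv ^^ j) q \<in> Pspace m v"
proof -
  obtain p where p: "q = pconv p v" "degree p \<le> m" using assms(2) by (auto simp: Pspace_def)
  have "degree ((pderiv ^^ j) p) \<le> m" using p(2) by (simp add: degree_higher_pderiv)
  then show ?thesis by (simp add: p(1) pconv_deriv assms(1) pconv_in_Pspace)
qed

section \<open>The subdivision operator on \<open>Pspace m v\<close> and its spectrum\<close>

context
  fixes a :: "int \<Rightarrow> complex^'r^'r" and v :: "int \<Rightarrow> complex^'r" and m :: nat
  assumes a: "fin_supp a" and v: "fin_supp v" and v0: "vsymbol v 0 \<noteq> 0"
begin

text \<open>The constant sequence is the convolution of \<open>1\<close> with \<open>v\<close>, and
  subdivision multiplies it by the constant term of \<open>c\<close>.\<close>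

lemma sr_cond_nth_0:
  assumes "sr_cond m a v c" "subdiv a (\<lambda>_. vsymbol v 0) = (\<lambda>_. vsymbol v 0)"
  shows "fps_nth c 0 = 1"
proof -
  have "vp_seq (pconv 1 v) = vp_seq (pconv (act c (half 1)) v)"
    using sr_cond_subdiv[OF a v assms(1), of 1] assms(2) by (simp add: pconv_1 v)
  then have "1 = act c (half 1)" by (simp add: pconv_inject v v0)
  then have "coeff 1 0 = coeff (act c (half 1)) 0" by simp
  then show ?thesis by (simp only: act_half_1 coeff_smult) simp
qed

lemma subdiv_image_eq:
  assumes c: "sr_cond m a v c" "fps_nth c 0 = 1"
  shows "subdiv a ` vp_seq ` Pspace m v = vp_seq ` Pspace m v"
    and "subdiv a (\<lambda>_. vsymbol v 0) = (\<lambda>_. vsymbol v 0)"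
proof -
  have S: "subdiv a (vp_seq (pconv q v)) = vp_seq (pconv (act c (half q)) v)" if "degree q \<le> m" for q
    using sr_cond_subdiv[OF a v c(1) that] .
  show "subdiv a (\<lambda>_. vsymbol v 0) = (\<lambda>_. vsymbol v 0)"
    using S[of 1] unfolding act_half_1 c(2) smult_1_left pconv_1[OF v] by simp
  show "subdiv a ` vp_seq ` Pspace m v = vp_seq ` Pspace m v"
  proof (intro subset_antisym subsetI)
    fix w assume "w \<in> subdiv a ` vp_seq ` Pspace m v"
    then obtain q where q: "degree q \<le> m" "w = subdiv a (vp_seq (pconv q v))"
      by (auto simp: Pspace_def)
    then show "w \<in> vp_seq ` Pspace m v"
      using order.trans[OF degree_act_le[of c "half q"]] by (simp add: S pconv_in_Pspace)
  next
    fix w assume "w \<in> vp_seq ` Pspace m v"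
    then obtain q where q: "degree q \<le> m" "w = vp_seq (pconv q v)"
      by (auto simp: Pspace_def)
    \<comment> \<open>Inverse of the scalar operator: \<open>c\<close> is a unit, and substituting
      2x undoes the halving.\<close>
    define q' where "q' = act (inverse c) q \<circ>\<^sub>p [:0, 2:]"
    have "half q' = act (inverse c) q"
      by (simp add: q'_def pcompose_pCons flip: pcompose_assoc)
    then have "act c (half q') = q"
      using inverse_mult_eq_1'[of c] c(2) by (simp flip: act_mult)
    moreover have "degree q' \<le> m"
      using q(1) degree_act_le[of "inverse c" q] by (simp add: q'_def degree_pcompose)
    ultimately show "w \<in> subdiv a ` vp_seq ` Pspace m v"
      using S[of q'] q(2) by (metis image_eqI pconv_in_Pspace)
  qed
qed

lemma subdiv_epoly_imp_sr_cond:
  assumes "subdiv a (vp_seq (pconv (epoly m) v)) \<in> vp_seq ` Pspace m v"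
  obtains c where "sr_cond m a v c"
proof -
  obtain q1 where "degree q1 \<le> m" "subdiv a (vp_seq (pconv (epoly m) v)) = vp_seq (pconv q1 v)"
    using assms by (auto simp: Pspace_def)
  then show ?thesis
    using subdiv_imp_sr_cond[OF a v degree_epoly epoly_nonzero] that by metis
qed

lemma subdiv_eigen_iff:
  assumes c: "sr_cond m a v c" and q: "degree q \<le> m"
  shows "subdiv a (vp_seq (pconv q v)) = (\<lambda>k. l *s vp_seq (pconv q v) k) \<longleftrightarrow> act c (half q) = smult l q"
  unfolding sr_cond_subdiv[OF a v c q] vp_seq_scale[symmetric] pconv_smult[OF v, symmetric]
  by (simp add: pconv_inject v v0)

text \<open>Compare leading coefficients: halving contributes \<open>1 / 2 ^ degree q\<close> and
  \<open>c\<close> its constant term.\<close>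

lemma eigenvalues_on_subset:
  assumes c: "sr_cond m a v c"
  shows "eigenvalues_on (subdiv a) (vp_seq ` Pspace m v) \<subseteq> {fps_nth c 0 / 2 ^ j | j. j \<le> m}"
proof
  fix l assume "l \<in> eigenvalues_on (subdiv a) (vp_seq ` Pspace m v)"
  then obtain q where q: "degree q \<le> m" "vp_seq (pconv q v) \<noteq> (\<lambda>_. 0)"
    "subdiv a (vp_seq (pconv q v)) = (\<lambda>k. l *s vp_seq (pconv q v) k)"
    by (auto simp: eigenvalues_on_def Pspace_def)
  have "q \<noteq> 0" using q(2) by (auto simp: pconv_0 v vp_seq_0)
  have "act c (half q) = smult l q" using subdiv_eigen_iff[OF c q(1)] q(3) by blast
  then have "coeff (act c (half q)) (degree (half q)) = l * lead_coeff q" by simp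
  then have "fps_nth c 0 / 2 ^ degree q * lead_coeff q = l * lead_coeff q"
    unfolding coeff_degree_act by (simp add: coeff_pcompose_linear power_one_over)
  then have "l = fps_nth c 0 / 2 ^ degree q"
    using \<open>q \<noteq> 0\<close> mult_right_cancel leading_coeff_neq_0 by metis
  then show "l \<in> {fps_nth c 0 / 2 ^ j | j. j \<le> m}" using q(1) by blast
qed

lemma eigenvalue_nth_0:
  assumes c: "sr_cond m a v c"
  shows "fps_nth c 0 \<in> eigenvalues_on (subdiv a) (vp_seq ` Pspace m v)"
proof -
  have "vp_seq (pconv 1 v) \<noteq> (\<lambda>_. 0)"
    by (metis pconv_1 v v0)
  moreover have "subdiv a (vp_seq (pconv 1 v)) = (\<lambda>k. fps_nth c 0 *s vp_seq (pconv 1 v) k)"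
    using subdiv_eigen_iff[OF c, of 1] act_half_1[of c] by simp
  moreover have "vp_seq (pconv 1 v) \<in> vp_seq ` Pspace m v"
    by (simp add: pconv_in_Pspace)
  ultimately show ?thesis unfolding eigenvalues_on_def by blast
qed

text \<open>The constant term is an eigenvalue, hence 2^(-j) for some j; and the eigenvalue
  \<open>1\<close> must be this term divided by some 2^k. Thus 2^(j+k) = 1 and j = k = 0.\<close>

lemma eigenvalues_imp_nth_0:
  assumes c: "sr_cond m a v c"
    and eig: "eigenvalues_on (subdiv a) (vp_seq ` Pspace m v) = {1 / 2 ^ j | j. j \<le> m}"
  shows "fps_nth c 0 = 1"
proof -
  obtain j where j: "fps_nth c 0 = 1 / 2 ^ j"
    using eigenvalue_nth_0[OF c] unfolding eig by blast
  have "1 / 2 ^ 0 \<in> {1 / 2 ^ j | j. j \<le> m}" by blast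
  then obtain k where "1 = fps_nth c 0 / 2 ^ k"
    using eigenvalues_on_subset[OF c] unfolding eig by fastforce
  then have "(2 :: complex) ^ (j + k) = 1" by (simp add: j power_add field_simps)
  then have "norm ((2 :: complex) ^ (j + k)) = 1" by simp
  then have "(2 :: real) ^ (j + k) = 1" by (simp add: norm_power)
  then have "j + k = 0" using one_less_power[of "2::real" "j + k"] by (cases "j + k = 0") auto
  then show ?thesis by (simp add: j)
qed

text \<open>For \<open>u\<close> the factor \<open>c\<close> is \<open>1\<close>, so subdivision
  becomes plain halving, of which \<open>epoly j\<close> is an eigenvector for
  \<open>1 / 2 ^ j\<close>.\<close>

lemma sum_rule_vector_eigenvectors:
  assumes "sum_rule_vector m a v u"
  shows "Pspace m u = Pspace m v"
    and "degree q \<le> m \<Longrightarrow> subdiv a (vp_seq (pconv q u)) = vp_seq (pconv (half q) u)"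
    and "j \<le> m \<Longrightarrow> subdiv a (vp_seq (pconv (epoly j) u)) = vp_seq (vp_scale (1 / 2 ^ j) (pconv (epoly j) u))"
    and "j \<le> m \<Longrightarrow> pconv (epoly j) u = (vp_deriv ^^ (m - j)) (pconv (epoly m) u)"
    and "vp_has_degree (pconv (epoly j) u) j"
    and "vp_eval (pconv (epoly j) u) x = (\<Sum>k=0..j. ((- \<i>) ^ k / (fact k * fact (j - k)) * x ^ (j - k))
                                *s nth_deriv k (vsymbol u) 0)"
proof -
  obtain d where u: "fin_supp u" and d: "fps_nth d 0 = 1" "\<And>i. vfps u i = d * vfps v i"
    and sr: "sr_cond m a u 1" using sum_rule_vectorD[OF a v assms] by blast
  have u0: "vsymbol u 0 \<noteq> 0"
  proof -
    have "vsymbol u 0 = vsymbol v 0"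
      by (simp add: vec_eq_iff d flip: vfps_nth_0[OF u] vfps_nth_0[OF v])
    then show ?thesis using v0 by simp
  qed
  \<comment> \<open>As \<open>d\<close> is a unit, passing from \<open>v\<close> to \<open>u\<close>
    only permutes the polynomials of degree at most \<open>m\<close>.\<close>
  have conv: "pconv q u = pconv (act d q) v" for q
    by (simp add: vec_eq_iff pconv_nth u v d(2) mult.commute flip: act_mult)
  show "Pspace m u = Pspace m v"
  proof (intro subset_antisym subsetI)
    fix x assume "x \<in> Pspace m u"
    then show "x \<in> Pspace m v"
      using degree_act_le order.trans by (fastforce simp: Pspace_def conv)
  next
    fix x assume "x \<in> Pspace m v"
    then obtain q where q: "x = pconv q v" "degree q \<le> m" by (auto simp: Pspace_def)
    have "pconv (act (inverse d) q) u = x"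
      using inverse_mult_eq_1'[of d] d(1) by (simp add: conv q(1) flip: act_mult)
    moreover have "degree (act (inverse d) q) \<le> m" using degree_act_le q(2) order.trans by blast
    ultimately show "x \<in> Pspace m u" by (auto simp: Pspace_def)
  qed
  show S: "subdiv a (vp_seq (pconv q u)) = vp_seq (pconv (half q) u)" if "degree q \<le> m" for q
    using sr_cond_subdiv[OF a u sr that] by simp
  show "subdiv a (vp_seq (pconv (epoly j) u)) = vp_seq (vp_scale (1 / 2 ^ j) (pconv (epoly j) u))" if "j \<le> m"
    using that by (simp add: S half_epoly pconv_smult u)
  show "pconv (epoly j) u = (vp_deriv ^^ (m - j)) (pconv (epoly m) u)" if "j \<le> m"
    using that by (simp add: pconv_deriv u higher_pderiv_epoly)
  show "vp_has_degree (pconv (epoly j) u) j"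
    by (simp add: vp_has_degree_pconv u u0)
  show "vp_eval (pconv (epoly j) u) x = (\<Sum>k=0..j. ((- \<i>) ^ k / (fact k * fact (j - k)) * x ^ (j - k))
                                *s nth_deriv k (vsymbol u) 0)"
    by (rule vp_eval_pconv_epoly[OF u])
qed

text \<open>Leading coefficients bound the spectrum from above; the convolutions of the
  \<open>epoly j\<close> with a sum rule vector attain every value.\<close>

lemma eigenvalues_on_eq:
  assumes c: "sr_cond m a v c" "fps_nth c 0 = 1"
  shows "eigenvalues_on (subdiv a) (vp_seq ` Pspace m v) = {1 / 2 ^ j | j. j \<le> m}"
proof
  show "eigenvalues_on (subdiv a) (vp_seq ` Pspace m v) \<subseteq> {1 / 2 ^ j | j. j \<le> m}"
    using eigenvalues_on_subset[OF c(1)] c(2) by simp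
  obtain u where u: "sum_rule_vector m a v u" using ex_sum_rule_vector[OF a v c(2,1)] by blast
  show "{1 / 2 ^ j | j. j \<le> m} \<subseteq> eigenvalues_on (subdiv a) (vp_seq ` Pspace m v)"
  proof clarify
    fix j assume j: "j \<le> m"
    let ?w = "vp_seq (pconv (epoly j) u)"
    have "?w \<in> vp_seq ` Pspace m v"
      using j sum_rule_vector_eigenvectors(1)[OF u] pconv_in_Pspace[of "epoly j" m u] by auto
    moreover have "?w \<noteq> (\<lambda>_. 0)"
      using sum_rule_vector_eigenvectors(5)[OF u, of j] by (simp add: vp_has_degree_def flip: vp_seq_0)
    moreover have "subdiv a ?w = (\<lambda>k. (1 / 2 ^ j) *s ?w k)"
      using sum_rule_vector_eigenvectors(3)[OF u j] by (simp add: vp_seq_scale)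
    ultimately show "1 / 2 ^ j \<in> eigenvalues_on (subdiv a) (vp_seq ` Pspace m v)"
      unfolding eigenvalues_on_def by blast
  qed
qed

text \<open>By the parity splitting a polynomial image can only be the convolution of the halved
  polynomial with \<open>a\<close>, so this is the witness \<open>s\<close>. Closure under
  derivatives extends it to all \<open>j\<close>.\<close>

lemma subdiv_derivs:
  assumes c: "sr_cond m a v c" and q: "q \<in> Pspace m v"
  shows "\<exists>s. subdiv a (vp_seq q) = vp_seq s \<and>
            (\<forall>j. subdiv a (vp_seq ((vp_deriv ^^ j) q)) = vp_seq (vp_scale (2 ^ j) ((vp_deriv ^^ j) s)) \<and>
                 vp_scale (2 ^ j) ((vp_deriv ^^ j) s) = vpconv (vp_half ((vp_deriv ^^ j) q)) a \<and>
                 (\<forall>x. (\<lambda>k. ((- \<i>) ^ k / (fact k * 2 ^ k)) *s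
                            (vp_eval (vp_half ((vp_deriv ^^ (j + k)) q)) x v*
                             nth_deriv k (msymbol a) 0))
                      sums vp_eval (vpconv (vp_half ((vp_deriv ^^ j) q)) a) x))"
proof -
  have S: "subdiv a (vp_seq p) = vp_seq (vpconv (vp_half p) a)" if p: "p \<in> Pspace m v" for p
  proof -
    obtain p0 where "p = pconv p0 v" "degree p0 \<le> m" using p by (auto simp: Pspace_def)
    then show ?thesis
      using sr_cond_subdiv[OF a v c] subdiv_eq_vp_seq_iff[OF a] by metis
  qed
  have D: "(vp_deriv ^^ k) ((vp_deriv ^^ j) q) = (vp_deriv ^^ (j + k)) q" for j k
    by (metis funpow_add comp_apply add.commute)
  show ?thesis
    using S[OF q] S[OF Pspace_deriv[OF v q]] vp_scale_deriv_vpconv[OF a, of _ q]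
      sums_vpconv[OF a, of "(vp_deriv ^^ _) q"]
    unfolding D by (intro exI[of _ "vpconv (vp_half q) a"]) auto
qed

end

section \<open>Equivalence of the six items and their consequences\<close>

theorem theorem1p2:
  fixes a :: "int \<Rightarrow> complex^'r^'r" and v :: "int \<Rightarrow> complex^'r" and m :: nat
  assumes "fin_supp a" and "fin_supp v" and "vsymbol v 0 \<noteq> 0"
  shows "let
      S = subdiv a;
      P = vp_seq ` Pspace m v;
      p = pconv (monom (1 / fact m) m) v;
      pj = (\<lambda>u j. pconv (monom (1 / fact j) j) u);
      s1 = (S ` P = P \<and> S (\<lambda>_. vsymbol v 0) = (\<lambda>_. vsymbol v 0));
      s2 = (S (vp_seq p) \<in> vp_seq ` module.span vp_scale {(vp_deriv ^^ j) p | j. j \<le> m} \<and>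
            S (vp_seq ((vp_deriv ^^ m) p)) = vp_seq ((vp_deriv ^^ m) p));
      s3 = (\<exists>c. fin_supp c \<and> symbol c 0 = 1 \<and>
            eq_upto_O (m + 1) (\<lambda>\<xi>. vsymbol v (2 * \<xi>) v* msymbol a \<xi>)
                              (\<lambda>\<xi>. symbol c \<xi> *s vsymbol v \<xi>) \<and>
            eq_upto_O (m + 1) (\<lambda>\<xi>. vsymbol v (2 * \<xi>) v* msymbol a (\<xi> + pi)) (\<lambda>\<xi>. 0));
      s4 = (\<exists>u. sum_rule_vector m a v u);
      s5 = (S ` P \<subseteq> P \<and>
            eigenvalues_on S P = {1 / 2 ^ j | j. j \<le> m} \<and>
            (\<forall>u. sum_rule_vector m a v u \<longrightarrow>
               Pspace m u = Pspace m v \<and>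
               (\<forall>j\<le>m.
                  S (vp_seq (pj u j)) = vp_seq (vp_scale (1 / 2 ^ j) (pj u j)) \<and>
                  pj u j = (vp_deriv ^^ (m - j)) (pj u m) \<and>
                  (\<forall>x. vp_eval (pj u j) x =
                     (\<Sum>k=0..j. ((- \<i>) ^ k / (fact k * fact (j - k)) * x ^ (j - k))
                                *s nth_deriv k (vsymbol u) 0)) \<and>
                  vp_has_degree (pj u j) j)));
      s6 = (\<exists>q\<in>Pspace m v. vp_has_degree q m \<and> S (vp_seq q) = vp_seq (vp_scale (1 / 2 ^ m) q))
    in
      (s1 \<longleftrightarrow> s2) \<and> (s2 \<longleftrightarrow> s3) \<and> (s3 \<longleftrightarrow> s4) \<and> (s4 \<longleftrightarrow> s5) \<and> (s5 \<longleftrightarrow> s6) \<and>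
      (s1 \<or> s2 \<or> s3 \<or> s4 \<or> s5 \<or> s6 \<longrightarrow>
         (\<forall>u. sum_rule_vector m a v u \<longrightarrow>
            (\<forall>q. degree q \<le> m \<longrightarrow>
               S (vp_seq (pconv q u)) = vp_seq (pconv (q \<circ>\<^sub>p [:0, 1/2:]) u))) \<and>
         (\<forall>q\<in>Pspace m v. \<exists>s. S (vp_seq q) = vp_seq s \<and>
            (\<forall>j. S (vp_seq ((vp_deriv ^^ j) q)) = vp_seq (vp_scale (2 ^ j) ((vp_deriv ^^ j) s)) \<and>
                 vp_scale (2 ^ j) ((vp_deriv ^^ j) s) = vpconv (vp_half ((vp_deriv ^^ j) q)) a \<and>
                 (\<forall>x. (\<lambda>k. ((- \<i>) ^ k / (fact k * 2 ^ k)) *s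
                            (vp_eval (vp_half ((vp_deriv ^^ (j + k)) q)) x v*
                             nth_deriv k (msymbol a) 0))
                      sums vp_eval (vpconv (vp_half ((vp_deriv ^^ j) q)) a) x))))"
proof -
  note av = assms(1,2) and avv = assms
  \<comment> \<open>The hub of the argument: every item is shown equivalent to
    \<open>H\<close>.\<close>
  define H where "H \<longleftrightarrow> (\<exists>c. fps_nth c 0 = 1 \<and> sr_cond m a v c)"
  let ?S = "subdiv a"
  let ?P = "vp_seq ` Pspace m v"
  let ?p = "pconv (epoly m) v"
  define s1 where "s1 \<longleftrightarrow> ?S ` ?P = ?P \<and> ?S (\<lambda>_. vsymbol v 0) = (\<lambda>_. vsymbol v 0)"
  define s2 where "s2 \<longleftrightarrow> ?S (vp_seq ?p) \<in> vp_seq ` module.span vp_scale {(vp_deriv ^^ j) ?p | j. j \<le> m} \<and>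
            ?S (vp_seq ((vp_deriv ^^ m) ?p)) = vp_seq ((vp_deriv ^^ m) ?p)"
  define s3 where "s3 \<longleftrightarrow> (\<exists>c. fin_supp c \<and> symbol c 0 = 1 \<and>
            eq_upto_O (m + 1) (\<lambda>\<xi>. vsymbol v (2 * \<xi>) v* msymbol a \<xi>)
                              (\<lambda>\<xi>. symbol c \<xi> *s vsymbol v \<xi>) \<and>
            eq_upto_O (m + 1) (\<lambda>\<xi>. vsymbol v (2 * \<xi>) v* msymbol a (\<xi> + pi)) (\<lambda>\<xi>. 0))"
  define s4 where "s4 \<longleftrightarrow> (\<exists>u. sum_rule_vector m a v u)"
  define s5 where "s5 \<longleftrightarrow> (?S ` ?P \<subseteq> ?P \<and>
            eigenvalues_on ?S ?P = {1 / 2 ^ j | j. j \<le> m} \<and>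
            (\<forall>u. sum_rule_vector m a v u \<longrightarrow>
               Pspace m u = Pspace m v \<and>
               (\<forall>j\<le>m.
                  ?S (vp_seq (pconv (epoly j) u)) = vp_seq (vp_scale (1 / 2 ^ j) (pconv (epoly j) u)) \<and>
                  pconv (epoly j) u = (vp_deriv ^^ (m - j)) (pconv (epoly m) u) \<and>
                  (\<forall>x. vp_eval (pconv (epoly j) u) x =
                     (\<Sum>k=0..j. ((- \<i>) ^ k / (fact k * fact (j - k)) * x ^ (j - k))
                                *s nth_deriv k (vsymbol u) 0)) \<and>
                  vp_has_degree (pconv (epoly j) u) j)))"
  define s6 where "s6 \<longleftrightarrow> (\<exists>q\<in>Pspace m v. vp_has_degree q m \<and> ?S (vp_seq q) = vp_seq (vp_scale (1 / 2 ^ m) q))"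
  have p_mem: "vp_seq ?p \<in> ?P" by (simp add: pconv_in_Pspace)
  \<comment> \<open>The \<open>m\<close>-th derivative of \<open>epoly m\<close> is
    \<open>1\<close>, so the second halves of items (1) and (2) coincide.\<close>
  have p_deriv: "vp_seq ((vp_deriv ^^ m) ?p) = (\<lambda>_. vsymbol v 0)"
    using pconv_1[OF assms(2)]
    by (simp add: pconv_deriv assms(2) higher_pderiv_epoly) (simp add: epoly_def monom_0 one_pCons)
  have H_if: H if "?S (vp_seq ?p) \<in> ?P" "?S (\<lambda>_. vsymbol v 0) = (\<lambda>_. vsymbol v 0)"
    unfolding H_def using subdiv_epoly_imp_sr_cond[OF avv that(1)] sr_cond_nth_0[OF avv _ that(2)] by metis
  have 1: "s1 \<longleftrightarrow> H"
  proof
    assume s1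
    then show H using p_mem by (intro H_if) (auto simp: s1_def)
  next
    assume H
    then show s1 using subdiv_image_eq[OF avv] unfolding H_def s1_def by blast
  qed
  have 2: "s2 \<longleftrightarrow> H"
  proof
    assume s2
    then show H unfolding s2_def span_derivs_eq_Pspace[OF assms(2)] p_deriv by (intro H_if) auto
  next
    assume H
    then have s1 using 1 by blast
    then show s2 using p_mem unfolding s1_def s2_def span_derivs_eq_Pspace[OF assms(2)] p_deriv by blast
  qed
  have 3: "s3 \<longleftrightarrow> H"
  proof
    assume s3
    then obtain c where c: "fin_supp c" "symbol c 0 = 1" "sr_cond m a v (seq_fps c)"
      unfolding s3_def using sr_cond_iff_eq_upto_O[OF av expands_symbol] by blast
    then show H unfolding H_def using seq_fps_nth_0[OF c(1)] by auto
  next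
    assume H
    then obtain c where c: "fps_nth c 0 = 1" "sr_cond m a v c" by (auto simp: H_def)
    obtain w where w: "fin_supp w" "fps_eq_upto m (seq_fps w) c" using ex_seq_fps_eq_upto by blast
    \<comment> \<open>The condition depends on its factor only modulo X^(m+1), so \<open>c\<close>
      may be exchanged for the series of a sequence.\<close>
    have "sr_cond m a v (seq_fps w)"
      using c(2) fps_eq_upto_mult[OF w(2) fps_eq_upto_refl] unfolding sr_cond_def
      by (blast intro: fps_eq_upto_trans fps_eq_upto_sym)
    moreover have "symbol w 0 = 1"
      using seq_fps_nth_0[OF w(1)] w(2) c(1) by (simp add: fps_eq_upto_def)
    ultimately show s3
      unfolding s3_def using sr_cond_iff_eq_upto_O[OF av expands_symbol[OF w(1)]] w(1) by blast
  qed
  have 4: "s4 \<longleftrightarrow> H"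
  proof
    assume s4
    then obtain u where "sum_rule_vector m a v u" by (auto simp: s4_def)
    then obtain d where "fps_nth d 0 = 1" "sr_cond m a v (d * inverse (dil d))"
      using sum_rule_vectorD[OF av] by blast
    then show H unfolding H_def by (intro exI[of _ "d * inverse (dil d)"]) simp
  qed (auto simp: H_def s4_def ex_sum_rule_vector[OF av])
  have 5: "s5 \<longleftrightarrow> H"
  proof
    assume s5
    then have "?S (vp_seq ?p) \<in> ?P" and eig: "eigenvalues_on ?S ?P = {1 / 2 ^ j | j. j \<le> m}"
      using p_mem unfolding s5_def by blast+
    then obtain c where "sr_cond m a v c" using subdiv_epoly_imp_sr_cond[OF avv] by blast
    then show H using eigenvalues_imp_nth_0[OF avv _ eig] unfolding H_def by blast
  next
    assume H
    then obtain c where c: "sr_cond m a v c" "fps_nth c 0 = 1" by (auto simp: H_def)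
    show s5
      unfolding s5_def
    proof (intro conjI allI impI)
      show "?S ` ?P \<subseteq> ?P" using subdiv_image_eq(1)[OF avv c] by simp
      show "eigenvalues_on ?S ?P = {1 / 2 ^ j | j. j \<le> m}" by (rule eigenvalues_on_eq[OF avv c])
      fix u assume u: "sum_rule_vector m a v u"
      note ev = sum_rule_vector_eigenvectors[OF avv u]
      show "Pspace m u = Pspace m v" by (rule ev(1))
      fix j assume j: "j \<le> m"
      show "?S (vp_seq (pconv (epoly j) u)) = vp_seq (vp_scale (1 / 2 ^ j) (pconv (epoly j) u))"
        by (rule ev(3)[OF j])
      show "pconv (epoly j) u = (vp_deriv ^^ (m - j)) (pconv (epoly m) u)" by (rule ev(4)[OF j])
      show "vp_has_degree (pconv (epoly j) u) j" by (rule ev(5))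
      show "vp_eval (pconv (epoly j) u) x = (\<Sum>k=0..j. ((- \<i>) ^ k / (fact k * fact (j - k)) * x ^ (j - k))
          *s nth_deriv k (vsymbol u) 0)" for x
        by (rule ev(6))
    qed
  qed
  have 6: "s6 \<longleftrightarrow> H"
  proof
    assume s6
    then obtain q where q: "vp_has_degree (pconv q v) m"
        "?S (vp_seq (pconv q v)) = vp_seq (pconv (smult (1 / 2 ^ m) q) v)"
      by (auto simp: s6_def Pspace_def pconv_smult assms(2))
    then have q': "q \<noteq> 0" "degree q = m" by (simp_all add: vp_has_degree_pconv assms)
    obtain c where c: "sr_cond m a v c" "smult (1 / 2 ^ m) q = act c (half q)"
      by (rule subdiv_imp_sr_cond[OF av q'(2,1) _ q(2)]) (use q' in simp)
    \<comment> \<open>Leading coefficients again: the eigenvalue already equals the factor produced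
      by halving, so the constant term of \<open>c\<close> must be \<open>1\<close>.\<close>
    have "coeff (act c (half q)) (degree (half q)) = 1 / 2 ^ m * lead_coeff q"
      using c(2)[symmetric] q' by simp
    then have "fps_nth c 0 = 1"
      unfolding coeff_degree_act using q' leading_coeff_neq_0[OF q'(1)] by (simp add: coeff_pcompose_linear power_one_over)
    then show H using c H_def by blast
  next
    assume H
    then obtain u where u: "sum_rule_vector m a v u" using 4 by (auto simp: s4_def)
    note ev = sum_rule_vector_eigenvectors[OF avv u]
    show s6
      unfolding s6_def using ev(1) ev(3)[of m] ev(5)[of m] pconv_in_Pspace[of "epoly m" m u] by auto
  qed
  have 7: "(\<forall>u. sum_rule_vector m a v u \<longrightarrow>
            (\<forall>q. degree q \<le> m \<longrightarrow>
               ?S (vp_seq (pconv q u)) = vp_seq (pconv (half q) u)))"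
    using sum_rule_vector_eigenvectors(2)[OF avv] by blast
  have 8: "H \<Longrightarrow> q \<in> Pspace m v \<Longrightarrow> \<exists>s. ?S (vp_seq q) = vp_seq s \<and>
            (\<forall>j. ?S (vp_seq ((vp_deriv ^^ j) q)) = vp_seq (vp_scale (2 ^ j) ((vp_deriv ^^ j) s)) \<and>
                 vp_scale (2 ^ j) ((vp_deriv ^^ j) s) = vpconv (vp_half ((vp_deriv ^^ j) q)) a \<and>
                 (\<forall>x. (\<lambda>k. ((- \<i>) ^ k / (fact k * 2 ^ k)) *s
                            (vp_eval (vp_half ((vp_deriv ^^ (j + k)) q)) x v*
                             nth_deriv k (msymbol a) 0))
                      sums vp_eval (vpconv (vp_half ((vp_deriv ^^ j) q)) a) x))" for q
    using subdiv_derivs[OF avv] unfolding H_def by blast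
  show ?thesis
    unfolding Let_def epoly_def[symmetric] s1_def[symmetric] s2_def[symmetric] s3_def[symmetric]
      s4_def[symmetric] s5_def[symmetric] s6_def[symmetric]
      1 2 3 4 5 6
    using 7 8 by blast
qed

end
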